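(* Suppose that $h=T/N<1$ and let $p\in[0,\tfrac12)$. There exists a constant $C>0$, independent of $N$, such that $$\left| E\left|X^N(T)\right|^2_{H^{-p}}-E\left|X(T)\right|^2_{H^{-p}}\right|\leq C\, h^{p+\frac12}.$$ Here $X$ is the solution of the stochastic heat equation $dX(t)=\frac12\frac{d^2}{dx^2}X(t)\,dt+dW(t)$, $X(0)=0$, on $L^2(0,1)$ with Dirichlet boundary conditions, and $X^N$ is its implicit Euler approximation with time step $h$.
   Context: Let $(\Omega,\mathcal F,P)$ be a probability space, $T>0$ a fixed time, and $(W(t))_{t\ge0}$ a cylindrical Brownian motion on $L^2(0,1)$. For $m\ge1$ let $e_m(x)=\sqrt2\sin(m\pi x)$ and $\lambda_m=\frac12(\pi m)^2$; $(e_m)_{m\ge1}$ is a complete orthonormal basis of $L^2(0,1)$. The stochastic heat equation is $X(0)=0$, $X(t,0)=X(t,1)=0$ for $t\in[0,T]$, and $dX(t)=\frac12\frac{d^2}{dx^2}X(t)\,dt+dW(t)$. An $L^2(0,1)$-valued process $(X(t))_{t\in[0,T]}$ is a solution if $X(0)=0$ and for all $g\in H^1_0(0,1)\cap H^2(0,1)$, $$\langle X(t),g\rangle_{L^2(0,1)}=\int_0^t\Big\langle X(s),\tfrac12\tfrac{d^2}{dx^2}g\Big\rangle_{L^2(0,1)}ds+\langle W(t),g\rangle_{L^2(0,1)}.$$ This equation has a unique solution. Equivalently $X(t)=\sum_{m\ge1}X_{\lambda_m}(t)e_m$, where $X_{\lambda_m}(0)=0$, $dX_{\lambda_m}(t)=-\lambda_mX_{\lambda_m}(t)dt+dW_{\lambda_m}(t)$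 and $W_{\lambda_m}(t)=\langle W(t),e_m\rangle$ (independent one-dimensional Brownian motions). For $N\in\mathbb N^*$ (positive integers), $h:=T/N$ and $t_k:=kh$, $0\le k\le N$. The implicit Euler scheme is the $L^2(0,1)$-valued sequence $(X^N(t_k))_{k=0,\dots,N}$ with $X^N(t_0)=0$ and, for $k=0,\dots,N-1$ and all $g\in H^1_0(0,1)\cap H^2(0,1)$, $$\langle X^N(t_{k+1}),g\rangle=\langle X^N(t_k),g\rangle+h\Big\langle X^N(t_{k+1}),\tfrac12\tfrac{d^2}{dx^2}g\Big\rangle+\langle W(t_{k+1})-W(t_k),g\rangle .$$ It has a unique solution. Equivalently $X^N(t_k)=\sum_{m\ge1}X^N_{\lambda_m}(t_k)e_m$ with $X^N_{\lambda_m}(t_0)=0$ and $X^N_{\lambda_m}(t_{k+1})=X^N_{\lambda_m}(t_k)-\lambda_mhX^N_{\lambda_m}(t_{k+1})+W_{\lambda_m}(t_{k+1})-W_{\lambda_m}(t_k)$. For $p\ge0$, $H^{-p}$ is the completion of $L^2(0,1)$ for the norm given by $|u|^2_{H^{-p}}:=\sum_{m\ge1}\lambda_m^{-p}\langle u,e_m\rangle^2_{L^2(0,1)}$. *)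

theory Defs
  imports "HOL-Probability.Probability"
begin

text \<open>Elements of \<open>L\<^sup>2(0,1)\<close> are represented by square-integrable functions; two representatives
  that agree almost everywhere on \<open>(0,1)\<close> denote the same element. Values outside \<open>(0,1)\<close> are
  irrelevant.\<close>

abbreviation unit_leb :: "real measure" where
  "unit_leb \<equiv> lebesgue_on {0<..<1}"

definition L2 :: "(real \<Rightarrow> real) set" where
  "L2 = {f. f \<in> borel_measurable unit_leb \<and> integrable unit_leb (\<lambda>x. (f x)\<^sup>2)}"

definition L2_inner :: "(real \<Rightarrow> real) \<Rightarrow> (real \<Rightarrow> real) \<Rightarrow> real" where
  "L2_inner f g = (LINT x|unit_leb. f x * g x)"

definition L2_norm :: "(real \<Rightarrow> real) \<Rightarrow> real" where
  "L2_norm f = sqrt (L2_inner f f)"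

text \<open>The Borel \<open>\<sigma>\<close>-algebra of \<open>L\<^sup>2(0,1)\<close>, generated by the sets that are open for \<^const>\<open>L2_norm\<close>;
  such sets are closed under changing a representative on a null set.\<close>

definition L2_open :: "(real \<Rightarrow> real) set \<Rightarrow> bool" where
  "L2_open U \<longleftrightarrow> U \<subseteq> L2 \<and>
     (\<forall>u\<in>U. \<exists>r>0. \<forall>v\<in>L2. L2_norm (\<lambda>x. v x - u x) < r \<longrightarrow> v \<in> U)"

definition L2_borel :: "(real \<Rightarrow> real) measure" where
  "L2_borel = sigma L2 {U. L2_open U}"

text \<open>\<open>C\<^sub>c\<^sup>1(0,1)\<close>. A subset of \<open>(0,1)\<close> that is closed in the reals is compact.\<close>

definition Cc1 :: "(real \<Rightarrow> real) set" where
  "Cc1 = {\<phi>. (\<forall>x. \<phi> differentiable (at x)) \<and> continuous_on UNIV (deriv \<phi>) \<and>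
             closure {x. \<phi> x \<noteq> 0} \<subseteq> {0<..<1}}"

text \<open>Sobolev spaces on an interval, with \<open>C\<^sub>c\<^sup>1\<close> test functions, and \<open>H\<^sub>0\<^sup>1\<close> as the closure of
  \<open>C\<^sub>c\<^sup>1\<close> in \<open>H\<^sup>1\<close> (as in Brezis, Functional Analysis, Sobolev Spaces and PDE, Chapter 8).\<close>

definition weak_deriv :: "(real \<Rightarrow> real) \<Rightarrow> (real \<Rightarrow> real) \<Rightarrow> bool" where
  "weak_deriv u v \<longleftrightarrow> u \<in> L2 \<and> v \<in> L2 \<and>
     (\<forall>\<phi>\<in>Cc1. L2_inner u (deriv \<phi>) = - L2_inner v \<phi>)"

definition weak_deriv2 :: "(real \<Rightarrow> real) \<Rightarrow> (real \<Rightarrow> real) \<Rightarrow> bool" where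
  "weak_deriv2 u w \<longleftrightarrow> (\<exists>v. weak_deriv u v \<and> weak_deriv v w)"

definition H2 :: "(real \<Rightarrow> real) set" where
  "H2 = {u. \<exists>w. weak_deriv2 u w}"

definition H10 :: "(real \<Rightarrow> real) set" where
  "H10 = {u. \<exists>v. weak_deriv u v \<and>
     (\<exists>\<phi>. (\<forall>n::nat. \<phi> n \<in> Cc1) \<and>
        (\<lambda>n. L2_norm (\<lambda>x. \<phi> n x - u x)) \<longlonglongrightarrow> 0 \<and>
        (\<lambda>n. L2_norm (\<lambda>x. deriv (\<phi> n) x - v x)) \<longlonglongrightarrow> 0)}"

definition sin_basis :: "nat \<Rightarrow> real \<Rightarrow> real" where
  "sin_basis m x = sqrt 2 * sin (real m * pi * x)"

definition lam :: "nat \<Rightarrow> real" where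
  "lam m = (pi * real m)\<^sup>2 / 2"

text \<open>The indices of \<open>sin_basis\<close> and \<open>lam\<close> start at \<open>1\<close>, hence the shift by \<^const>\<open>Suc\<close>. The norm is only
  applied to elements of \<^const>\<open>L2\<close>, where the series converges for \<open>p \<ge> 0\<close>.\<close>

definition Hneg_norm :: "real \<Rightarrow> (real \<Rightarrow> real) \<Rightarrow> real" where
  "Hneg_norm p u = sqrt (\<Sum>m. lam (Suc m) powr (- p) * (L2_inner u (sin_basis (Suc m)))\<^sup>2)"

definition centered_normal :: "real \<Rightarrow> real measure" where
  "centered_normal v =
     (if v = 0 then return borel 0
      else density lborel (\<lambda>x. ennreal (normal_density 0 (sqrt v) x)))"

text \<open>A cylindrical Brownian motion on \<open>L\<^sup>2(0,1)\<close> does not take values in \<open>L\<^sup>2(0,1)\<close>; it is given by its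
  pairings \<open>W t g = \<langle>W(t), g\<rangle>\<close>. These form a centered Gaussian family with covariance
  \<open>min(s,t) \<langle>f, g\<rangle>\<close> and continuous paths. Linearity in \<open>g\<close> (almost surely) follows, since the
  combination \<open>W t (a f + b g) - a W t f - b W t g\<close> has variance zero; so does the fact that the
  \<open>W t (sin_basis m)\<close>, \<open>m \<ge> 1\<close>, are independent standard Brownian motions.\<close>

definition cylindrical_BM :: "'w measure \<Rightarrow> (real \<Rightarrow> (real \<Rightarrow> real) \<Rightarrow> 'w \<Rightarrow> real) \<Rightarrow> bool" where
  "cylindrical_BM M W \<longleftrightarrow>
     (\<forall>t\<ge>0. \<forall>g\<in>L2. W t g \<in> borel_measurable M) \<and>
     (\<forall>(n::nat) c \<tau> g. (\<forall>i<n. 0 \<le> \<tau> i \<and> g i \<in> L2) \<longrightarrow>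
        distr M borel (\<lambda>\<omega>. \<Sum>i<n. c i * W (\<tau> i) (g i) \<omega>) =
        centered_normal (\<Sum>i<n. \<Sum>j<n. c i * c j * (min (\<tau> i) (\<tau> j) * L2_inner (g i) (g j)))) \<and>
     (\<forall>g\<in>L2. AE \<omega> in M. continuous_on {0..} (\<lambda>t. W t g \<omega>))"

text \<open>In both definitions below \<open>g2\<close> is the second weak derivative of \<open>g\<close>, which is unique up to null
  sets. The identities hold almost surely for each fixed test function and each fixed time.\<close>

definition heat_solution ::
  "'w measure \<Rightarrow> (real \<Rightarrow> (real \<Rightarrow> real) \<Rightarrow> 'w \<Rightarrow> real) \<Rightarrow> real \<Rightarrow> (real \<Rightarrow> 'w \<Rightarrow> real \<Rightarrow> real) \<Rightarrow> bool" where
  "heat_solution M W T X \<longleftrightarrow>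
     (\<lambda>(t, \<omega>). X t \<omega>) \<in> (restrict_space borel {0..T} \<Otimes>\<^sub>M M) \<rightarrow>\<^sub>M L2_borel \<and>
     (AE \<omega> in M. AE x in unit_leb. X 0 \<omega> x = 0) \<and>
     (\<forall>g \<in> H10 \<inter> H2. \<forall>g2. weak_deriv2 g g2 \<longrightarrow>
       (\<forall>t\<in>{0..T}. AE \<omega> in M.
          set_integrable lborel {0..t} (\<lambda>s. L2_inner (X s \<omega>) (\<lambda>x. 1/2 * g2 x)) \<and>
          L2_inner (X t \<omega>) g =
            (LINT s:{0..t}|lborel. L2_inner (X s \<omega>) (\<lambda>x. 1/2 * g2 x)) + W t g \<omega>))"

definition implicit_euler ::
  "'w measure \<Rightarrow> (real \<Rightarrow> (real \<Rightarrow> real) \<Rightarrow> 'w \<Rightarrow> real) \<Rightarrow> real \<Rightarrow> nat \<Rightarrow>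
   (nat \<Rightarrow> 'w \<Rightarrow> real \<Rightarrow> real) \<Rightarrow> bool" where
  "implicit_euler M W T N Y \<longleftrightarrow>
     (let h = T / real N in
     (\<forall>k\<le>N. Y k \<in> M \<rightarrow>\<^sub>M L2_borel) \<and>
     (AE \<omega> in M. AE x in unit_leb. Y 0 \<omega> x = 0) \<and>
     (\<forall>k<N. \<forall>g \<in> H10 \<inter> H2. \<forall>g2. weak_deriv2 g g2 \<longrightarrow>
       (AE \<omega> in M. L2_inner (Y (Suc k) \<omega>) g =
          L2_inner (Y k \<omega>) g + h * L2_inner (Y (Suc k) \<omega>) (\<lambda>x. 1/2 * g2 x)
          + (W (real (Suc k) * h) g \<omega> - W (real k * h) g \<omega>))))"

end

theory Submission
  imports Defs
begin

text \<open>Only second moments matter, and they can be computed mode by mode. Write \<open>\<lambda>\<close> for an eigenvalue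
\<open>lam m\<close>. Testing both equations with \<open>sin_basis m\<close> decouples them: the \<open>m\<close>-th coefficient of the solution
obeys the scalar equation \<open>x(t) = -\<lambda> \<integral>\<^sub>0\<^sup>t x + W\<^sub>m(t)\<close>, and that of the Euler scheme the recursion
\<open>(1 + \<lambda>h) y(k+1) = y(k) + \<Delta>W\<^sub>m(k)\<close>. Both coefficients at time \<open>T\<close> are centered Gaussian, with variances
\<open>(1 - exp(-2\<lambda>T)) / (2\<lambda>)\<close> and \<open>(1 - (1 + \<lambda>h)^(-2N)) / (2\<lambda> + \<lambda>\<^sup>2h)\<close>
(\<open>heat_solution_mode_distribution\<close>, \<open>implicit_euler_mode_second_moment\<close>).

These variances differ by at most \<open>min(1, \<lambda>h) / \<lambda>\<close>, uniformly in \<open>N\<close> (\<open>mode_variance_error\<close>): the factor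
\<open>\<lambda>h\<close> is the consistency error of a mode that the step resolves, and \<open>1\<close> is the trivial bound for a mode that
it does not resolve. The claim follows by weighting with \<open>\<lambda>^(-p)\<close> and summing. Since \<open>\<lambda>\<close> grows like \<open>m\<^sup>2\<close>,
the modes \<open>m \<le> h^(-1/2)\<close> contribute about \<open>h \<Sum> m^(-2p)\<close> and the others about \<open>\<Sum> m^(-2p-2)\<close>; both sums are of
order \<open>h^(p+1/2)\<close> (\<open>suminf_mode_error_le\<close>). The condition \<open>p < 1/2\<close> is what makes the first one grow like
a power of the cut-off.

The work behind the two variance formulas is of three kinds. The sine functions have to be admissible test
functions, in particular limits in \<open>H\<^sup>1\<close> of functions with compact support in \<open>(0,1)\<close>
(\<open>sin_basis_in_H10\<close>). The scalar equation holds almost surely at each fixed time only, so Fubini's theorem is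
used to obtain, almost surely, an equation at almost every time, which can then be solved path by path. And no
stochastic integral is needed: the solution is a pathwise limit of sums \<open>\<Sum> exp(-\<lambda>(T-t)) \<Delta>W\<^sub>m(t)\<close>
(\<open>linear_equation_left_sums\<close>), whose Gaussian laws are known, and a limit of centered Gaussian variables is
again centered Gaussian (\<open>centered_normal_limit\<close>).\<close>

section \<open>The space \<open>L\<^sup>2(0,1)\<close>\<close>

lemma prob_space_unit_leb: "prob_space unit_leb"
  by (rule prob_spaceI) (simp add: emeasure_restrict_space)

lemma unit_leb_continuous:
  fixes f :: "real \<Rightarrow> real"
  assumes "continuous_on {0..1} f"
  shows "integrable unit_leb f" "(LINT x|unit_leb. f x) = integral {0..1} f"
proof -
  have "f absolutely_integrable_on {0..1}"
    using assms by (rule absolutely_integrable_continuous_real)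
  then have "f absolutely_integrable_on {0<..<1}"
    by (rule set_integrable_subset) auto
  then show I: "integrable unit_leb f"
    by (simp add: integrable_restrict_space set_integrable_def)
  show "(LINT x|unit_leb. f x) = integral {0..1} f"
    using lebesgue_integral_eq_integral[OF I] by (simp add: integral_open_interval_real)
qed

lemma continuous_in_L2:
  assumes "continuous_on {0..1} f"
  shows "f \<in> L2"
proof -
  have "integrable unit_leb (\<lambda>x. (f x)\<^sup>2)"
    by (intro unit_leb_continuous continuous_intros assms)
  moreover have "f \<in> borel_measurable unit_leb"
    using unit_leb_continuous(1)[OF assms] by auto
  ultimately show ?thesis by (simp add: L2_def)
qed

lemma L2_product_integrable:
  assumes "f \<in> L2" "g \<in> L2"
  shows "integrable unit_leb (\<lambda>x. f x * g x)"
proof (rule Bochner_Integration.integrable_bound)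
  show "integrable unit_leb (\<lambda>x. (f x)\<^sup>2 + (g x)\<^sup>2)"
    using assms by (auto simp: L2_def)
  show "(\<lambda>x. f x * g x) \<in> borel_measurable unit_leb"
    using assms by (auto simp: L2_def)
  have "\<bar>a * b\<bar> \<le> \<bar>a\<^sup>2 + b\<^sup>2\<bar>" for a b :: real
  proof -
    have "2 * \<bar>a * b\<bar> \<le> a\<^sup>2 + b\<^sup>2"
      using sum_squares_bound[of "\<bar>a\<bar>" "\<bar>b\<bar>"] by (simp add: abs_mult)
    then show ?thesis using abs_ge_zero[of "a * b"] by linarith
  qed
  then show "AE x in unit_leb. norm (f x * g x) \<le> norm ((f x)\<^sup>2 + (g x)\<^sup>2)"
    by simp
qed

lemma L2_diff: "f \<in> L2 \<Longrightarrow> g \<in> L2 \<Longrightarrow> (\<lambda>x. f x - g x) \<in> L2"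
  using L2_product_integrable[of f g]
  by (auto simp: L2_def power2_diff mult.assoc intro!: integrable_mult_right Bochner_Integration.integrable_diff Bochner_Integration.integrable_add)

text \<open>The usual discriminant argument: the integral of \<open>(a f - b g)\<^sup>2\<close> is a nonnegative quadratic form in
\<open>(a, b)\<close>.\<close>

lemma L2_Cauchy_Schwarz:
  assumes "f \<in> L2" "g \<in> L2"
  shows "\<bar>L2_inner f g\<bar> \<le> L2_norm f * L2_norm g"
proof -
  define A B C where "A = L2_inner f f" and "B = L2_inner f g" and "C = L2_inner g g"
  have AC: "A \<ge> 0" "C \<ge> 0"
    by (auto simp: A_def C_def L2_inner_def)
  note I = L2_product_integrable[OF assms] L2_product_integrable[OF assms(1) assms(1)]
     L2_product_integrable[OF assms(2) assms(2)]
  have quad: "0 \<le> a\<^sup>2 * A - 2 * a * b * B + b\<^sup>2 * C" for a b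
  proof -
    have "0 \<le> (LINT x|unit_leb. (a * f x - b * g x)\<^sup>2)" by simp
    also have "(\<lambda>x. (a * f x - b * g x)\<^sup>2) =
       (\<lambda>x. a\<^sup>2 * (f x * f x) - 2 * a * b * (f x * g x) + b\<^sup>2 * (g x * g x))"
      by (auto simp: fun_eq_iff power2_eq_square algebra_simps)
    also have "(LINT x|unit_leb. \<dots> x) = a\<^sup>2 * A - 2 * a * b * B + b\<^sup>2 * C"
      using I by (simp add: A_def B_def C_def L2_inner_def)
    finally show ?thesis .
  qed
  have "B\<^sup>2 \<le> A * C"
  proof (cases "C = 0")
    case True
    \<comment> \<open>The form is affine in \<open>b\<close>, so a nonzero slope would make it negative somewhere.\<close>
    have "B = 0"
    proof (rule ccontr)
      assume "B \<noteq> 0"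
      then show False
        using quad[of 1 "(A + 1) / (2 * B)"] AC True by (simp add: field_simps)
    qed
    with AC True show ?thesis by simp
  next
    case False
    have "0 \<le> C * (A * C - B\<^sup>2)"
      using quad[of C B] by (simp add: power2_eq_square algebra_simps)
    with False AC show ?thesis by (simp add: zero_le_mult_iff)
  qed
  then have "sqrt (B\<^sup>2) \<le> sqrt (A * C)" by (rule real_sqrt_le_mono)
  then show ?thesis by (simp add: L2_norm_def real_sqrt_mult A_def B_def C_def)
qed

text \<open>The coefficients of a random element of \<open>L\<^sup>2(0,1)\<close> are random variables: by the Cauchy-Schwarz inequality
the pairing with \<open>g\<close> is continuous.\<close>

lemma L2_inner_measurable:
  assumes g: "g \<in> L2"
  shows "(\<lambda>u. L2_inner u g) \<in> borel_measurable L2_borel"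
proof (rule borel_measurableI)
  fix S :: "real set" assume S: "open S"
  have sub: "{U. L2_open U} \<subseteq> Pow L2" by (auto simp: L2_open_def)
  let ?U = "{u \<in> L2. L2_inner u g \<in> S}"
  have "L2_open ?U"
    unfolding L2_open_def
  proof safe
    fix u assume u: "u \<in> L2" "L2_inner u g \<in> S"
    then obtain e where e: "e > 0" "\<And>y. dist y (L2_inner u g) < e \<Longrightarrow> y \<in> S"
      using S by (auto simp: open_dist)
    have N: "L2_norm g \<ge> 0" by (simp add: L2_norm_def L2_inner_def)
    show "\<exists>r>0. \<forall>v\<in>L2. L2_norm (\<lambda>x. v x - u x) < r \<longrightarrow> v \<in> ?U"
    proof (intro exI conjI ballI impI)
      show "e / (L2_norm g + 1) > 0" using e N by simp
      fix v assume v: "v \<in> L2" "L2_norm (\<lambda>x. v x - u x) < e / (L2_norm g + 1)"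
      have "L2_inner v g - L2_inner u g = L2_inner (\<lambda>x. v x - u x) g"
        using L2_product_integrable[OF v(1) g] L2_product_integrable[OF u(1) g]
        by (simp add: L2_inner_def left_diff_distrib)
      then have "\<bar>L2_inner v g - L2_inner u g\<bar> \<le> L2_norm (\<lambda>x. v x - u x) * L2_norm g"
        using L2_Cauchy_Schwarz[OF L2_diff[OF v(1) u(1)] g] by simp
      also have "\<dots> \<le> L2_norm (\<lambda>x. v x - u x) * (L2_norm g + 1)"
        by (intro mult_left_mono) (auto simp: L2_norm_def L2_inner_def)
      also have "\<dots> < e"
        using v(2) N by (simp add: field_simps)
      finally show "v \<in> ?U"
        using e v(1) by (auto simp: dist_real_def)
    qed
  qed
  moreover have "(\<lambda>u. L2_inner u g) -` S \<inter> space L2_borel = ?U"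
    using sub by (auto simp: L2_borel_def space_measure_of)
  ultimately show "(\<lambda>u. L2_inner u g) -` S \<inter> space L2_borel \<in> sets L2_borel"
    using sub by (auto simp: L2_borel_def sets_measure_of)
qed

section \<open>The sine functions as test functions\<close>

lemma Cc1_endpoints:
  assumes "\<phi> \<in> Cc1"
  shows "\<phi> 0 = 0" "\<phi> 1 = 0"
  using assms closure_subset[of "{x. \<phi> x \<noteq> 0}"] by (auto simp: Cc1_def)

text \<open>Integration by parts; a function in \<^const>\<open>Cc1\<close> vanishes at both endpoints, so there is no boundary
term.\<close>

lemma weak_deriv_classical:
  assumes d: "\<And>x. (u has_real_derivative v x) (at x)" and v: "continuous_on UNIV v"
  shows "weak_deriv u v"
proof -
  have u: "continuous_on UNIV u"
    using d by (meson DERIV_isCont continuous_at_imp_continuous_on)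
  have "L2_inner u (deriv \<phi>) = - L2_inner v \<phi>" if \<phi>: "\<phi> \<in> Cc1" for \<phi>
  proof -
    have d\<phi>: "(\<phi> has_real_derivative deriv \<phi> x) (at x)" for x
      using \<phi> by (auto simp: Cc1_def DERIV_deriv_iff_real_differentiable)
    have c\<phi>: "continuous_on UNIV \<phi>"
      using d\<phi> by (meson DERIV_isCont continuous_at_imp_continuous_on)
    have c': "continuous_on UNIV (deriv \<phi>)" using \<phi> by (simp add: Cc1_def)
    have "((\<lambda>x. v x * \<phi> x + u x * deriv \<phi> x) has_integral (u 1 * \<phi> 1 - u 0 * \<phi> 0)) {0..1}"
      by (rule fundamental_theorem_of_calculus)
        (auto intro!: derivative_eq_intros DERIV_subset[OF d] DERIV_subset[OF d\<phi>]
          simp: has_real_derivative_iff_has_vector_derivative[symmetric])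
    then have "integral {0..1} (\<lambda>x. v x * \<phi> x + u x * deriv \<phi> x) = 0"
      using Cc1_endpoints[OF \<phi>] by (simp add: integral_unique)
    moreover have cont: "continuous_on {0..1} (\<lambda>x. v x * \<phi> x)" "continuous_on {0..1} (\<lambda>x. u x * deriv \<phi> x)"
      by (intro continuous_intros continuous_on_subset[OF u] continuous_on_subset[OF v]
           continuous_on_subset[OF c\<phi>] continuous_on_subset[OF c']; simp)+
    ultimately show ?thesis
      using integral_add[OF cont[THEN integrable_continuous_real]] cont[THEN unit_leb_continuous(2)]
      by (simp add: L2_inner_def)
  qed
  moreover have "u \<in> L2" "v \<in> L2"
    by (intro continuous_in_L2 continuous_on_subset[OF u] continuous_on_subset[OF v]; simp)+
  ultimately show ?thesis by (simp add: weak_deriv_def)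
qed

definition cos_basis :: "nat \<Rightarrow> real \<Rightarrow> real" where
  "cos_basis m x = sqrt 2 * (real m * pi) * cos (real m * pi * x)"

lemma sin_basis_deriv: "(sin_basis m has_real_derivative cos_basis m x) (at x)"
  unfolding sin_basis_def[abs_def] cos_basis_def by (auto intro!: derivative_eq_intros)

lemma cos_basis_deriv: "(cos_basis m has_real_derivative (- 2 * lam m * sin_basis m x)) (at x)"
  unfolding cos_basis_def[abs_def] sin_basis_def lam_def
  by (auto intro!: derivative_eq_intros simp: power2_eq_square)

lemma continuous_sin_basis: "continuous_on A (sin_basis m)"
  unfolding sin_basis_def[abs_def] by (intro continuous_intros)

lemma continuous_cos_basis: "continuous_on A (cos_basis m)"
  unfolding cos_basis_def[abs_def] by (intro continuous_intros)

lemma sin_basis_in_L2: "sin_basis m \<in> L2"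
  by (intro continuous_in_L2 continuous_sin_basis)

lemma weak_deriv_sin_basis: "weak_deriv (sin_basis m) (cos_basis m)"
  by (intro weak_deriv_classical sin_basis_deriv continuous_cos_basis)

lemma weak_deriv2_sin_basis: "weak_deriv2 (sin_basis m) (\<lambda>x. - 2 * lam m * sin_basis m x)"
  unfolding weak_deriv2_def
  by (intro exI[of _ "cos_basis m"] conjI weak_deriv_sin_basis weak_deriv_classical cos_basis_deriv
     continuous_intros continuous_sin_basis)

lemma L2_inner_sin_basis_self:
  assumes "m \<ge> 1"
  shows "L2_inner (sin_basis m) (sin_basis m) = 1"
proof -
  define c where "c = real m * pi"
  have c: "c > 0" using assms by (simp add: c_def)
  have "((\<lambda>x. 1 - cos (2 * c * x)) has_integral
      ((1 - sin (2 * c * 1) / (2 * c)) - (0 - sin (2 * c * 0) / (2 * c)))) {0..1}"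
    using c by (intro fundamental_theorem_of_calculus)
        (auto intro!: derivative_eq_intros
          simp: has_real_derivative_iff_has_vector_derivative[symmetric])
  moreover have "sin (2 * c) = 0"
    unfolding c_def by (metis mult.assoc mult.commute of_nat_mult of_nat_numeral sin_npi)
  moreover have "sin_basis m x * sin_basis m x = 1 - cos (2 * c * x)" for x
  proof -
    have "sin_basis m x * sin_basis m x = 2 * (sin (c * x))\<^sup>2"
      by (simp add: sin_basis_def c_def power2_eq_square)
    also have "\<dots> = 1 - cos (2 * (c * x))" by (simp add: cos_double_sin)
    finally show ?thesis by (simp add: mult.assoc)
  qed
  ultimately have "integral {0..1} (\<lambda>x. sin_basis m x * sin_basis m x) = 1"
    by (simp add: integral_unique)
  then show ?thesis
    unfolding L2_inner_def
    by (subst unit_leb_continuous(2)) (auto intro!: continuous_intros continuous_sin_basis)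
qed

text \<open>The squared positive part is the building block of a cut-off that is \<open>C\<^sup>1\<close> but vanishes on an interval.\<close>

lemma DERIV_max_zero_squared: "((\<lambda>y. (max 0 y)\<^sup>2) has_real_derivative 2 * max 0 y) (at (y::real))"
proof -
  consider "y > 0" | "y < 0" | "y = 0" by linarith
  then show ?thesis
  proof cases
    case 1
    have "((\<lambda>y. y\<^sup>2) has_real_derivative 2 * max 0 y) (at y)"
      using 1 by (auto intro!: derivative_eq_intros)
    then show ?thesis
      by (rule has_field_derivative_transform_within_open[where S="{0<..}"]) (use 1 in auto)
  next
    case 2
    have "((\<lambda>y. 0) has_real_derivative 2 * max 0 y) (at y)"
      using 2 by (auto intro!: derivative_eq_intros)
    then show ?thesis
      by (rule has_field_derivative_transform_within_open[where S="{..<0}"]) (use 2 in auto)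
  next
    case 3
    have "((\<lambda>h. (max 0 h)\<^sup>2 / h) \<longlongrightarrow> 0) (at (0::real))"
    proof (rule Lim_null_comparison)
      show "\<forall>\<^sub>F h in at (0::real). norm ((max 0 h)\<^sup>2 / h) \<le> \<bar>h\<bar>"
        by (rule always_eventually) (auto simp: max_def power2_eq_square)
      show "(abs \<longlongrightarrow> 0) (at (0::real))" by (intro tendsto_rabs_zero tendsto_ident_at)
    qed
    then show ?thesis using 3 by (simp add: DERIV_def)
  qed
qed

text \<open>A \<open>C\<^sup>1\<close> approximation of the identity that vanishes on \<open>[-e, e]\<close>. Composing it with a function that
is zero on the boundary gives a function with compact support in the interior. The square root in the denominator
brings the quadratic growth of the numerator down to \<open>u\<close>, without a singularity at the origin.\<close>

definition shrink :: "real \<Rightarrow> real \<Rightarrow> real" where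
  "shrink e u = ((max 0 (u - e))\<^sup>2 - (max 0 (- u - e))\<^sup>2) / sqrt (u\<^sup>2 + e\<^sup>2)"

definition shrink' :: "real \<Rightarrow> real \<Rightarrow> real" where
  "shrink' e u = (2 * max 0 (u - e) + 2 * max 0 (- u - e)) / sqrt (u\<^sup>2 + e\<^sup>2)
     - shrink e u * u / (u\<^sup>2 + e\<^sup>2)"

lemma shrink_eq_0: "\<bar>u\<bar> \<le> e \<Longrightarrow> shrink e u = 0"
  by (auto simp: shrink_def max_def)

lemma shrink_deriv:
  assumes "e > 0"
  shows "(shrink e has_real_derivative shrink' e u) (at u)"
proof -
  have pos: "u\<^sup>2 + e\<^sup>2 > 0" using assms by (simp add: add_nonneg_pos)
  have lin: "((\<lambda>u. u - e) has_real_derivative 1) (at u)" "((\<lambda>u. - u - e) has_real_derivative - 1) (at u)"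
    by (auto intro!: derivative_eq_intros)
  have "((\<lambda>u. (max 0 (u - e))\<^sup>2) has_real_derivative 2 * max 0 (u - e)) (at u)"
    using DERIV_chain2[OF DERIV_max_zero_squared lin(1)] by simp
  moreover have "((\<lambda>u. (max 0 (- u - e))\<^sup>2) has_real_derivative - 2 * max 0 (- u - e)) (at u)"
    using DERIV_chain2[OF DERIV_max_zero_squared lin(2)] by simp
  moreover have "((\<lambda>u. sqrt (u\<^sup>2 + e\<^sup>2)) has_real_derivative u / sqrt (u\<^sup>2 + e\<^sup>2)) (at u)"
  proof -
    have "((\<lambda>u. u\<^sup>2 + e\<^sup>2) has_real_derivative 2 * u) (at u)"
      by (auto intro!: derivative_eq_intros)
    from DERIV_chain2[where f = sqrt, OF DERIV_real_sqrt[OF pos] this] show ?thesis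
      by (simp add: inverse_eq_divide)
  qed
  ultimately have "(shrink e has_real_derivative
      ((2 * max 0 (u - e) - - 2 * max 0 (- u - e)) * sqrt (u\<^sup>2 + e\<^sup>2)
        - ((max 0 (u - e))\<^sup>2 - (max 0 (- u - e))\<^sup>2) * (u / sqrt (u\<^sup>2 + e\<^sup>2)))
      / (sqrt (u\<^sup>2 + e\<^sup>2) * sqrt (u\<^sup>2 + e\<^sup>2))) (at u)"
    unfolding shrink_def[abs_def] using pos by (intro DERIV_divide DERIV_diff) auto
  moreover have "(a * s - n * (u / s)) / (s * s) = a / s - n / s * u / (s * s)"
    if "s > 0" for a n s :: real
    using that by (simp add: diff_divide_distrib)
  note this[of "sqrt (u\<^sup>2 + e\<^sup>2)" "2 * max 0 (u - e) - - 2 * max 0 (- u - e)"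
     "(max 0 (u - e))\<^sup>2 - (max 0 (- u - e))\<^sup>2"]
  moreover have "sqrt (u\<^sup>2 + e\<^sup>2) * sqrt (u\<^sup>2 + e\<^sup>2) = u\<^sup>2 + e\<^sup>2" by simp
  ultimately show ?thesis
    using pos unfolding shrink'_def shrink_def[of e u] by simp
qed

lemma continuous_shrink': "e > 0 \<Longrightarrow> continuous_on A (shrink' e)"
  unfolding shrink'_def[abs_def] shrink_def[abs_def]
  by (intro continuous_intros) (auto simp: add_nonneg_eq_0_iff)

lemma abs_shrink_le:
  assumes "e > 0"
  shows "\<bar>shrink e u\<bar> \<le> \<bar>u\<bar>"
proof -
  have s: "sqrt (u\<^sup>2 + e\<^sup>2) \<ge> \<bar>u\<bar>" by (rule real_le_rsqrt) simp
  have s0: "sqrt (u\<^sup>2 + e\<^sup>2) > 0" using assms by (simp add: add_nonneg_pos)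
  have "\<bar>(max 0 (u - e))\<^sup>2 - (max 0 (- u - e))\<^sup>2\<bar> \<le> \<bar>u\<bar>\<^sup>2"
  proof (cases "u \<ge> 0")
    case True
    then have "(max 0 (u - e))\<^sup>2 \<le> u\<^sup>2" "max 0 (- u - e) = 0"
      using assms by (auto intro!: power_mono)
    then show ?thesis by simp
  next
    case False
    then have "(max 0 (- u - e))\<^sup>2 \<le> (- u)\<^sup>2"
      using assms by (intro power_mono) auto
    moreover have "max 0 (u - e) = 0" using False assms by simp
    ultimately have "(max 0 (- u - e))\<^sup>2 \<le> (- u)\<^sup>2" "max 0 (u - e) = 0" by simp_all
    then show ?thesis by simp
  qed
  also have "\<dots> \<le> \<bar>u\<bar> * sqrt (u\<^sup>2 + e\<^sup>2)"
    using mult_left_mono[OF s, of "\<bar>u\<bar>"] by (simp add: power2_eq_square)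
  finally show ?thesis
    using s0 by (simp add: shrink_def field_simps)
qed

text \<open>The bound is uniform in \<open>e\<close>; it provides the dominating function when \<open>e\<close> tends to zero.\<close>

lemma abs_shrink'_le:
  assumes "e > 0"
  shows "\<bar>shrink' e u\<bar> \<le> 3"
proof -
  have s: "sqrt (u\<^sup>2 + e\<^sup>2) \<ge> \<bar>u\<bar>" by (rule real_le_rsqrt) simp
  have s0: "sqrt (u\<^sup>2 + e\<^sup>2) > 0" "u\<^sup>2 + e\<^sup>2 > 0" using assms by (auto simp add: add_nonneg_pos)
  have "0 \<le> 2 * max 0 (u - e) + 2 * max 0 (- u - e)" "2 * max 0 (u - e) + 2 * max 0 (- u - e) \<le> 2 * \<bar>u\<bar>"
    using assms by (auto simp: max_def)
  then have "0 \<le> 2 * max 0 (u - e) + 2 * max 0 (- u - e)"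
    "2 * max 0 (u - e) + 2 * max 0 (- u - e) \<le> 2 * sqrt (u\<^sup>2 + e\<^sup>2)"
    using s by linarith+
  then have "\<bar>(2 * max 0 (u - e) + 2 * max 0 (- u - e)) / sqrt (u\<^sup>2 + e\<^sup>2)\<bar> \<le> 2"
    using s0 by (simp add: abs_of_nonneg pos_divide_le_eq)
  moreover have "\<bar>shrink e u * u / (u\<^sup>2 + e\<^sup>2)\<bar> \<le> 1"
  proof -
    have "\<bar>shrink e u * u\<bar> \<le> \<bar>u\<bar> * \<bar>u\<bar>"
      unfolding abs_mult by (rule mult_right_mono[OF abs_shrink_le[OF assms]]) simp
    also have "\<dots> \<le> u\<^sup>2 + e\<^sup>2" by (simp add: power2_eq_square)
    finally show ?thesis
      using s0(2) by (simp only: abs_divide abs_of_pos pos_divide_le_eq mult_1)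
  qed
  ultimately have "\<bar>shrink' e u\<bar> \<le> 2 + 1"
    unfolding shrink'_def by (rule order_trans[OF abs_triangle_ineq4 add_mono])
  then show ?thesis by simp
qed

lemma shrink_tendsto:
  assumes "e \<longlonglongrightarrow> 0" "\<And>n. e n > 0"
  shows "(\<lambda>n. shrink (e n) u) \<longlonglongrightarrow> u"
proof (cases "u = 0")
  case True
  then show ?thesis using assms(2) by (simp add: shrink_eq_0 less_imp_le)
next
  case False
  have "(\<lambda>n. shrink (e n) u) \<longlonglongrightarrow> shrink 0 u"
    unfolding shrink_def using False by (intro tendsto_intros assms(1)) auto
  moreover have "shrink 0 u = u"
    using False by (auto simp: shrink_def max_def power2_eq_square)
  ultimately show ?thesis by simp
qed

lemma shrink'_tendsto:
  assumes "e \<longlonglongrightarrow> 0" "\<And>n. e n > 0" "u \<noteq> 0"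
  shows "(\<lambda>n. shrink' (e n) u) \<longlonglongrightarrow> 1"
proof -
  have "(\<lambda>n. shrink' (e n) u) \<longlonglongrightarrow> (2 * max 0 (u - 0) + 2 * max 0 (- u - 0)) / sqrt (u\<^sup>2 + 0\<^sup>2)
     - u * u / (u\<^sup>2 + 0\<^sup>2)"
    unfolding shrink'_def using assms by (intro tendsto_intros shrink_tendsto) auto
  also have "(2 * max 0 (u - 0) + 2 * max 0 (- u - 0)) / sqrt (u\<^sup>2 + 0\<^sup>2) - u * u / (u\<^sup>2 + 0\<^sup>2) = 1"
    using assms(3) by (auto simp: max_def power2_eq_square)
  finally show ?thesis .
qed

lemma AE_unit_leb_iff: "(AE x in unit_leb. P x) \<longleftrightarrow> (AE x in lebesgue. x \<in> {0<..<1} \<longrightarrow> P x)"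
  by (rule AE_restrict_space_iff) simp

text \<open>The derivative of \<^const>\<open>shrink\<close> at the origin is zero for every \<open>e\<close> and does not converge to \<open>1\<close>. So
the zeros of the sine function must be negligible.\<close>

lemma sin_basis_nonzero_AE:
  assumes "m \<ge> 1"
  shows "AE x in unit_leb. sin_basis m x \<noteq> 0"
proof -
  let ?Z = "range (\<lambda>i::int. of_int i / real m)"
  have "countable ?Z" by simp
  then have "?Z \<in> null_sets lborel" by (rule countable_imp_null_set_lborel)
  then have "AE x in lborel. x \<notin> ?Z" by (rule AE_not_in)
  then have "AE x in lebesgue. x \<notin> ?Z" by (rule AE_completion)
  moreover have "x \<in> ?Z" if z: "sin_basis m x = 0" for x
  proof -
    obtain i :: int where "real m * pi * x = of_int i * pi"
      using z by (auto simp: sin_basis_def sin_zero_iff_int2)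
    then have "x = of_int i / real m" using assms by (simp add: field_simps)
    then show ?thesis by auto
  qed
  ultimately have "AE x in lebesgue. sin_basis m x \<noteq> 0" by (auto elim!: eventually_mono)
  then show ?thesis by (auto simp: AE_unit_leb_iff elim!: eventually_mono)
qed

lemma L2_norm_tendsto_dominated:
  assumes meas: "\<And>n. f n \<in> L2" "g \<in> L2"
    and lim: "AE x in unit_leb. (\<lambda>n. f n x) \<longlonglongrightarrow> g x"
    and bound: "\<And>n x. x \<in> {0<..<1} \<Longrightarrow> \<bar>f n x - g x\<bar> \<le> K"
  shows "(\<lambda>n. L2_norm (\<lambda>x. f n x - g x)) \<longlonglongrightarrow> 0"
proof -
  interpret prob_space unit_leb by (rule prob_space_unit_leb)
  have "(\<lambda>n. LINT x|unit_leb. (f n x - g x)\<^sup>2) \<longlonglongrightarrow> (LINT x|unit_leb. 0)"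
  proof (rule integral_dominated_convergence[where w = "\<lambda>_. K\<^sup>2"])
    show "(\<lambda>x. (f n x - g x)\<^sup>2) \<in> borel_measurable unit_leb" for n
      using L2_diff[OF meas(1) meas(2)] by (auto simp: L2_def)
    show "AE x in unit_leb. (\<lambda>n. (f n x - g x)\<^sup>2) \<longlonglongrightarrow> 0"
      using lim by eventually_elim (auto intro!: tendsto_eq_intros)
    show "AE x in unit_leb. norm ((f n x - g x)\<^sup>2) \<le> K\<^sup>2" for n
    proof (rule AE_I2)
      fix x assume "x \<in> space unit_leb"
      then have "\<bar>f n x - g x\<bar> \<le> K" using bound by simp
      then have "\<bar>f n x - g x\<bar>\<^sup>2 \<le> K\<^sup>2" by (rule power_mono) simp
      then show "norm ((f n x - g x)\<^sup>2) \<le> K\<^sup>2" by simp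
    qed
  qed auto
  then have "(\<lambda>n. sqrt (LINT x|unit_leb. (f n x - g x)\<^sup>2)) \<longlonglongrightarrow> sqrt 0"
    by (intro tendsto_real_sqrt) simp
  then show ?thesis by (simp add: L2_norm_def L2_inner_def power2_eq_square)
qed

text \<open>Outside \<open>(0,1)\<close> the sine function continues periodically, so it has to be cut off there explicitly.\<close>

definition sin_cut :: "nat \<Rightarrow> real \<Rightarrow> real \<Rightarrow> real" where
  "sin_cut m e x = (if x \<in> {0<..<1} then shrink e (sin_basis m x) else 0)"

definition sin_cut' :: "nat \<Rightarrow> real \<Rightarrow> real \<Rightarrow> real" where
  "sin_cut' m e x = (if x \<in> {0<..<1} then shrink' e (sin_basis m x) * cos_basis m x else 0)"

lemma sin_basis_endpoints: "sin_basis m 0 = 0" "sin_basis m 1 = 0"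
  by (auto simp: sin_basis_def)

lemma
  assumes e: "e > 0"
  shows sin_cut_deriv: "(sin_cut m e has_real_derivative sin_cut' m e x) (at x)"
    and continuous_sin_cut': "continuous_on UNIV (sin_cut' m e)"
    and sin_cut_Cc1: "sin_cut m e \<in> Cc1"
proof -
  \<comment> \<open>Near the endpoints the absolute value of the sine is smaller than \<open>e\<close>, so the set where the cut function vanishes
     has an interior that covers the complement of \<open>(0,1)\<close>. All local properties are then checked on two open sets.\<close>
  define U where "U = {..<0} \<union> {1<..} \<union> {x. \<bar>sin_basis m x\<bar> < e}"
  have U: "open U"
    unfolding U_def by (intro open_Un open_lessThan open_greaterThan open_Collect_less continuous_intros continuous_sin_basis)
  have UN: "{0<..<1} \<union> U = UNIV"
    using e by (auto simp: U_def sin_basis_endpoints)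
  have Z: "sin_cut m e x = 0" if "x \<in> U" for x
    using that by (auto simp: U_def sin_cut_def intro!: shrink_eq_0)
  have Z': "sin_cut' m e x = 0" if "x \<in> U" for x
    using that e by (auto simp: U_def sin_cut'_def shrink'_def shrink_eq_0)
  have D: "(sin_cut m e has_real_derivative sin_cut' m e x) (at x)" for x
  proof (cases "x \<in> U")
    case True
    have "((\<lambda>x. 0) has_real_derivative sin_cut' m e x) (at x)" using Z'[OF True] by simp
    then show ?thesis
      by (rule has_field_derivative_transform_within_open[where S=U]) (use True U Z in auto)
  next
    case False
    then have x: "x \<in> {0<..<1}" using UN by auto
    have "((\<lambda>x. shrink e (sin_basis m x)) has_real_derivative sin_cut' m e x) (at x)"
      using x DERIV_chain2[OF shrink_deriv[OF e] sin_basis_deriv] by (simp add: sin_cut'_def)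
    then show ?thesis
      by (rule has_field_derivative_transform_within_open[where S="{0<..<1}"])
        (use x in \<open>auto simp: sin_cut_def\<close>)
  qed
  then show "(sin_cut m e has_real_derivative sin_cut' m e x) (at x)" .
  have "continuous_on {0<..<1} (sin_cut' m e) \<longleftrightarrow>
      continuous_on {0<..<1} (\<lambda>x. shrink' e (sin_basis m x) * cos_basis m x)"
    by (rule continuous_on_cong) (auto simp: sin_cut'_def)
  then have "continuous_on {0<..<1} (sin_cut' m e)"
    by (auto intro!: continuous_intros continuous_cos_basis
        continuous_on_compose2[OF continuous_shrink'[OF e, of UNIV] continuous_sin_basis])
  moreover have "continuous_on U (sin_cut' m e) \<longleftrightarrow> continuous_on U (\<lambda>x. 0 :: real)"
    by (rule continuous_on_cong) (auto simp: Z')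
  ultimately show C: "continuous_on UNIV (sin_cut' m e)"
    using continuous_on_open_Un[of "{0<..<1}" U "sin_cut' m e"] U UN by auto
  have "closed ({0..1} \<inter> {x. e \<le> \<bar>sin_basis m x\<bar>})"
    by (intro closed_Int closed_atLeastAtMost closed_Collect_le continuous_intros continuous_sin_basis)
  moreover have "{x. sin_cut m e x \<noteq> 0} \<subseteq> {0..1} \<inter> {x. e \<le> \<bar>sin_basis m x\<bar>}"
    using Z by (auto simp: U_def not_less) (use linorder_not_less in blast)+
  ultimately have "closure {x. sin_cut m e x \<noteq> 0} \<subseteq> {0..1} \<inter> {x. e \<le> \<bar>sin_basis m x\<bar>}"
    by (rule closure_minimal[rotated])
  also have "\<dots> \<subseteq> {0<..<1}"
    using e sin_basis_endpoints[of m] by (auto simp: less_le)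
  finally have "closure {x. sin_cut m e x \<noteq> 0} \<subseteq> {0<..<1}" .
  moreover have "deriv (sin_cut m e) = sin_cut' m e"
    using D by (auto intro!: ext DERIV_imp_deriv)
  ultimately show "sin_cut m e \<in> Cc1"
    using D C by (auto simp: Cc1_def real_differentiable_def)
qed

lemma sin_basis_in_H10:
  assumes m: "m \<ge> 1"
  shows "sin_basis m \<in> H10"
proof -
  define e where "e n = 1 / real (Suc n)" for n
  have e: "e n > 0" for n by (simp add: e_def)
  have e0: "e \<longlonglongrightarrow> 0" unfolding e_def by (rule LIMSEQ_Suc) (rule lim_1_over_n)
  have L2: "sin_cut m (e n) \<in> L2" "sin_cut' m (e n) \<in> L2" for n
    using continuous_on_subset[OF continuous_sin_cut'[OF e]] DERIV_isCont[OF sin_cut_deriv[OF e]]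
    by (auto intro!: continuous_in_L2 simp: continuous_at_imp_continuous_on)
  have sb: "\<bar>sin_basis m x\<bar> \<le> sqrt 2" for x
    using mult_left_mono[OF abs_sin_le_one, of "sqrt 2"] by (simp add: sin_basis_def abs_mult)
  have cb: "\<bar>cos_basis m x\<bar> \<le> sqrt 2 * (real m * pi)" for x
    using mult_left_mono[OF abs_cos_le_one, of "sqrt 2 * (real m * pi)"] by (simp add: cos_basis_def abs_mult)
  have "(\<lambda>n. L2_norm (\<lambda>x. sin_cut m (e n) x - sin_basis m x)) \<longlonglongrightarrow> 0"
  proof (rule L2_norm_tendsto_dominated[where K = "2 * sqrt 2"])
    show "AE x in unit_leb. (\<lambda>n. sin_cut m (e n) x) \<longlonglongrightarrow> sin_basis m x"
      using shrink_tendsto[OF e0 e] by (auto intro!: AE_I2 simp: sin_cut_def)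
    fix n and x :: real assume "x \<in> {0<..<1}"
    then show "\<bar>sin_cut m (e n) x - sin_basis m x\<bar> \<le> 2 * sqrt 2"
      using abs_shrink_le[OF e, of n "sin_basis m x"] sb[of x] by (simp add: sin_cut_def)
  qed (auto simp: L2 sin_basis_in_L2)
  moreover have "(\<lambda>n. L2_norm (\<lambda>x. sin_cut' m (e n) x - cos_basis m x)) \<longlonglongrightarrow> 0"
  proof (rule L2_norm_tendsto_dominated[where K = "4 * (sqrt 2 * (real m * pi))"])
    have "AE x in unit_leb. x \<in> {0<..<1}" by (auto simp: AE_unit_leb_iff)
    then show "AE x in unit_leb. (\<lambda>n. sin_cut' m (e n) x) \<longlonglongrightarrow> cos_basis m x"
      using sin_basis_nonzero_AE[OF m]
      by eventually_elim (use shrink'_tendsto[OF e0 e] in \<open>auto simp: sin_cut'_def intro!: tendsto_eq_intros\<close>)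
    fix n and x :: real assume "x \<in> {0<..<1}"
    moreover have "\<bar>shrink' (e n) (sin_basis m x) - 1\<bar> \<le> 4"
      using abs_shrink'_le[OF e, of n "sin_basis m x"] by linarith
    then have "\<bar>shrink' (e n) (sin_basis m x) - 1\<bar> * \<bar>cos_basis m x\<bar> \<le> 4 * (sqrt 2 * (real m * pi))"
      using cb by (intro mult_mono) auto
    ultimately show "\<bar>sin_cut' m (e n) x - cos_basis m x\<bar> \<le> 4 * (sqrt 2 * (real m * pi))"
      by (simp add: sin_cut'_def left_diff_distrib flip: abs_mult)
  qed (auto simp: L2 intro!: continuous_in_L2 continuous_cos_basis)
  moreover have "deriv (sin_cut m (e n)) = sin_cut' m (e n)" for n
    using sin_cut_deriv[OF e] by (auto intro!: ext DERIV_imp_deriv)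
  ultimately show ?thesis
    unfolding H10_def using weak_deriv_sin_basis sin_cut_Cc1[OF e]
    by (auto intro!: exI[of _ "cos_basis m"] exI[of _ "\<lambda>n. sin_cut m (e n)"])
qed

lemma sin_basis_test_function:
  assumes "m \<ge> 1"
  shows "sin_basis m \<in> H10 \<inter> H2"
  using sin_basis_in_H10[OF assms] weak_deriv2_sin_basis by (auto simp: H2_def)

section \<open>Centered Gaussian variables and Brownian increments\<close>

lemma second_moment_centered_normal:
  assumes "v \<ge> 0"
  shows "(\<integral>\<^sup>+x. ennreal (x\<^sup>2) \<partial>centered_normal v) = ennreal v"
proof (cases "v = 0")
  case True
  then show ?thesis by (simp add: centered_normal_def nn_integral_return)
next
  case False
  then have v: "sqrt v > 0" using assms by simp
  have "(\<integral>\<^sup>+x. ennreal (x\<^sup>2) \<partial>centered_normal v)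
     = (\<integral>\<^sup>+x. ennreal (normal_density 0 (sqrt v) x * (x - 0) ^ (2 * 1)) \<partial>lborel)"
    using False by (simp add: centered_normal_def nn_integral_density ennreal_mult')
  also have "\<dots> = ennreal (\<integral>x. normal_density 0 (sqrt v) x * (x - 0) ^ (2 * 1) \<partial>lborel)"
    using integrable.intros[OF normal_moment_even[OF v, of 0 1]]
    by (intro nn_integral_eq_integral) auto
  also have "(\<integral>x. normal_density 0 (sqrt v) x * (x - 0) ^ (2 * 1) \<partial>lborel) = v"
    unfolding integral_normal_moment_even[OF v] using assms by (simp add: power_divide fact_2)
  finally show ?thesis .
qed

lemma char_centered_normal:
  assumes "v \<ge> 0"
  shows "char (centered_normal v) u = complex_of_real (exp (- v * u\<^sup>2 / 2))"
proof (cases "v = 0")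
  case True
  then show ?thesis by (simp add: centered_normal_def char_def integral_return)
next
  case False
  define \<sigma> where "\<sigma> = sqrt v"
  have \<sigma>: "\<sigma> > 0" "\<sigma>\<^sup>2 = v" using False assms by (auto simp: \<sigma>_def)
  have dens: "\<sigma> * normal_density 0 \<sigma> (0 + \<sigma> * x) = std_normal_density x" for x
    using \<sigma>(1) by (simp add: normal_density_def real_sqrt_mult power_mult_distrib)
  have "char (centered_normal v) u = (CLINT x|lborel. normal_density 0 \<sigma> x *\<^sub>R iexp (u * x))"
    using False by (simp add: centered_normal_def char_def integral_density \<sigma>_def)
  also have "\<dots> = \<bar>\<sigma>\<bar> *\<^sub>R (CLINT x|lborel. normal_density 0 \<sigma> (0 + \<sigma> * x) *\<^sub>R iexp (u * (0 + \<sigma> * x)))"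
    using \<sigma> by (intro lborel_integral_real_affine) simp
  also have "\<dots> = (CLINT x|lborel. std_normal_density x *\<^sub>R iexp ((\<sigma> * u) * x))"
    using \<sigma> unfolding dens[symmetric] integral_scaleR_right[symmetric] by (simp add: mult_ac)
  also have "\<dots> = char std_normal_distribution (\<sigma> * u)"
    by (simp add: char_def integral_density)
  finally show ?thesis
    using \<sigma> by (simp add: char_std_normal_distribution power_mult_distrib)
qed

lemma real_distribution_centered_normal:
  assumes "v \<ge> 0"
  shows "real_distribution (centered_normal v)"
proof -
  have "prob_space (centered_normal v)"
    using assms by (auto simp: centered_normal_def intro: prob_space_return prob_space_normal_density)
  then show ?thesis
    by (auto simp: real_distribution_def real_distribution_axioms_def centered_normal_def)
qed

text \<open>Characteristic functions converge by dominated convergence, and those of Gaussian laws depend continuously on the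
variance; the law of the limit is then determined by Levy's uniqueness theorem.\<close>

lemma centered_normal_limit:
  assumes "prob_space M"
    and S [measurable]: "\<And>n::nat. S n \<in> borel_measurable M" and Y [measurable]: "Y \<in> borel_measurable M"
    and lim: "AE \<omega> in M. (\<lambda>n. S n \<omega>) \<longlonglongrightarrow> Y \<omega>"
    and d: "\<And>n. distr M borel (S n) = centered_normal (v n)"
    and v: "\<And>n. v n \<ge> 0" "v \<longlonglongrightarrow> w"
  shows "distr M borel Y = centered_normal w"
proof -
  interpret prob_space M by fact
  have w: "w \<ge> 0" using LIMSEQ_le_const[OF v(2)] v(1) by auto
  have char_eq: "char (distr M borel Z) u = (CLINT \<omega>|M. iexp (u * Z \<omega>))"
    if [measurable]: "Z \<in> borel_measurable M" for Z u
    unfolding char_def by (subst integral_distr) auto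
  have "char (distr M borel Y) u = char (centered_normal w) u" for u
  proof (rule LIMSEQ_unique)
    have "(\<lambda>n. CLINT \<omega>|M. iexp (u * S n \<omega>)) \<longlonglongrightarrow> (CLINT \<omega>|M. iexp (u * Y \<omega>))"
    proof (rule integral_dominated_convergence[where w = "\<lambda>_. 1"])
      show "AE \<omega> in M. (\<lambda>n. iexp (u * S n \<omega>)) \<longlonglongrightarrow> iexp (u * Y \<omega>)"
        using lim by eventually_elim (intro tendsto_intros)
    qed auto
    then show "(\<lambda>n. char (centered_normal (v n)) u) \<longlonglongrightarrow> char (distr M borel Y) u"
      by (simp add: char_eq flip: d)
    show "(\<lambda>n. char (centered_normal (v n)) u) \<longlonglongrightarrow> char (centered_normal w) u"
      unfolding char_centered_normal[OF v(1)] char_centered_normal[OF w] by (intro tendsto_intros v) simp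
  qed
  then show ?thesis
    by (intro Levy_uniqueness real_distribution_centered_normal w real_distribution_distr Y) auto
qed

lemma second_moment_of_centered_normal:
  assumes "Y \<in> borel_measurable M" "distr M borel Y = centered_normal v" "v \<ge> 0"
  shows "(\<integral>\<^sup>+\<omega>. ennreal ((Y \<omega>)\<^sup>2) \<partial>M) = ennreal v"
proof -
  have "(\<integral>\<^sup>+\<omega>. ennreal ((Y \<omega>)\<^sup>2) \<partial>M) = (\<integral>\<^sup>+x. ennreal (x\<^sup>2) \<partial>distr M borel Y)"
    using assms(1) by (subst nn_integral_distr) auto
  with assms(2,3) show ?thesis by (simp add: second_moment_centered_normal)
qed

lemma sum_lessThan_add: "(\<Sum>i<n+m. f i) = (\<Sum>i<n. f i) + (\<Sum>i<m. f (n + i))"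
  for f :: "nat \<Rightarrow> 'a::comm_monoid_add"
  by (induction m) (simp_all add: add.assoc)

lemma cylindrical_BM_linear_combination:
  fixes n :: nat
  assumes "cylindrical_BM M W" "\<forall>i<n. 0 \<le> \<tau> i \<and> g i \<in> L2"
  shows "distr M borel (\<lambda>\<omega>. \<Sum>i<n. c i * W (\<tau> i) (g i) \<omega>) =
     centered_normal (\<Sum>i<n. \<Sum>j<n. c i * c j * (min (\<tau> i) (\<tau> j) * L2_inner (g i) (g j)))"
proof -
  have "\<forall>(n::nat) c \<tau> g. (\<forall>i<n. 0 \<le> \<tau> i \<and> g i \<in> L2) \<longrightarrow>
        distr M borel (\<lambda>\<omega>. \<Sum>i<n. c i * W (\<tau> i) (g i) \<omega>) =
        centered_normal (\<Sum>i<n. \<Sum>j<n. c i * c j * (min (\<tau> i) (\<tau> j) * L2_inner (g i) (g j)))"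
    using assms(1) unfolding cylindrical_BM_def by (elim conjE)
  from this[rule_format, of n \<tau> g c] assms(2) show ?thesis by blast
qed

text \<open>Disjoint increments of \<open>W\<close> are uncorrelated. The definition of a cylindrical Brownian motion speaks about
linear combinations of its values, so the \<open>n\<close> increments are expanded into \<open>2n\<close> terms, of which the first half
holds the right endpoints.\<close>

lemma cylindrical_BM_increments:
  assumes W: "cylindrical_BM M W" and g: "g \<in> L2" "L2_inner g g = 1"
    and t: "0 \<le> t 0" "mono t"
  shows "distr M borel (\<lambda>\<omega>. \<Sum>k<n. a k * (W (t (Suc k)) g \<omega> - W (t k) g \<omega>)) =
    centered_normal (\<Sum>k<n. (a k)\<^sup>2 * (t (Suc k) - t k))"
proof -
  define c where "c i = (if i < n then a i else - a (i - n))" for i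
  define \<tau> where "\<tau> i = (if i < n then t (Suc i) else t (i - n))" for i
  have t0: "0 \<le> t k" for k using t monoD[OF t(2), of 0 k] by simp
  have "\<forall>i<n+n. 0 \<le> \<tau> i \<and> g \<in> L2" using t0 g by (simp add: \<tau>_def)
  then have "distr M borel (\<lambda>\<omega>. \<Sum>i<n+n. c i * W (\<tau> i) g \<omega>) =
     centered_normal (\<Sum>i<n+n. \<Sum>j<n+n. c i * c j * (min (\<tau> i) (\<tau> j) * L2_inner g g))"
    by (rule cylindrical_BM_linear_combination[OF W, where g = "\<lambda>_. g"])
  moreover have "(\<Sum>i<n+n. c i * W (\<tau> i) g \<omega>) = (\<Sum>k<n. a k * (W (t (Suc k)) g \<omega> - W (t k) g \<omega>))" for \<omega>
    by (simp add: sum_lessThan_add c_def \<tau>_def right_diff_distrib sum_subtractf sum_negf)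
  moreover have "(\<Sum>i<n+n. \<Sum>j<n+n. c i * c j * (min (\<tau> i) (\<tau> j) * L2_inner g g)) =
    (\<Sum>k<n. (a k)\<^sup>2 * (t (Suc k) - t k))"
  proof -
    have cov: "min (t (Suc i)) (t (Suc j)) - min (t (Suc i)) (t j) - min (t i) (t (Suc j)) + min (t i) (t j)
       = (if i = j then t (Suc i) - t i else 0)" for i j
    proof -
      have "t i \<le> t (Suc i)" "t j \<le> t (Suc j)" using t(2) by (auto simp: mono_iff_le_Suc)
      moreover have "t (Suc i) \<le> t j" if "i < j" using monoD[OF t(2), of "Suc i" j] that by simp
      moreover have "t (Suc j) \<le> t i" if "j < i" using monoD[OF t(2), of "Suc j" i] that by simp
      ultimately show ?thesis by (cases i j rule: linorder_cases) (auto simp: min_def)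
    qed
    have "(\<Sum>i<n+n. \<Sum>j<n+n. c i * c j * (min (\<tau> i) (\<tau> j) * L2_inner g g)) =
      (\<Sum>i<n. \<Sum>j<n. a i * a j * (min (t (Suc i)) (t (Suc j)) - min (t (Suc i)) (t j) - min (t i) (t (Suc j)) + min (t i) (t j)))"
      by (simp add: sum_lessThan_add c_def \<tau>_def g algebra_simps sum.distrib sum_subtractf sum_negf)
    also have "\<dots> = (\<Sum>i<n. \<Sum>j<n. if i = j then a i * a j * (t (Suc i) - t i) else 0)"
      unfolding cov by (intro sum.cong refl) simp
    also have "\<dots> = (\<Sum>k<n. (a k)\<^sup>2 * (t (Suc k) - t k))"
      by (simp add: power2_eq_square)
    finally show ?thesis .
  qed
  ultimately show ?thesis by simp
qed

section \<open>A linear equation driven by a continuous path\<close>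

text \<open>The equation holds only almost everywhere, and \<open>x\<close> is only integrable. But its integral is continuous, hence
the right-hand side of the equation is a continuous representative of \<open>x\<close>, and the integral is even continuously
differentiable.\<close>

lemma linear_equation_integral_DERIV:
  fixes x b :: "real \<Rightarrow> real"
  assumes "0 \<le> T" and b: "continuous_on {0..T} b" and x: "set_integrable lborel {0..T} x"
    and ae: "AE s in lborel. s \<in> {0..T} \<longrightarrow> x s = b s - l * (LINT r:{0..s}|lborel. x r)"
    and t: "t \<in> {0..T}"
  shows "((\<lambda>t. LINT r:{0..t}|lborel. x r) has_real_derivative
     b t - l * (LINT r:{0..t}|lborel. x r)) (at t within {0..T})"
proof -
  have z: "(LINT r:{0..s}|lborel. x r) = integral {0..s} x" if "s \<in> {0..T}" for s
    using that by (intro set_borel_integral_eq_integral set_integrable_subset[OF x]) auto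
  define y where "y s = b s - l * integral {0..s} x" for s
  have y: "continuous_on {0..T} y"
    unfolding y_def using set_borel_integral_eq_integral(1)[OF x]
    by (intro continuous_intros b indefinite_integral_continuous_1)
  have "AE s in lebesgue. s \<in> {0..T} \<longrightarrow> x s = y s"
    using AE_completion[OF ae] by eventually_elim (auto simp: y_def z)
  then obtain N where N: "N \<in> null_sets lebesgue" "{s. \<not> (s \<in> {0..T} \<longrightarrow> x s = y s)} \<subseteq> N"
    unfolding eventually_ae_filter by auto
  have eq: "(LINT r:{0..s}|lborel. x r) = integral {0..s} y" if "s \<in> {0..T}" for s
    unfolding z[OF that] using N that
    by (intro integral_spike[where S = N]) (auto simp: negligible_iff_null_sets)
  have "((\<lambda>t. integral {0..t} y) has_real_derivative y t) (at t within {0..T})"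
    by (rule integral_has_real_derivative[OF y t])
  then have "((\<lambda>t. LINT r:{0..t}|lborel. x r) has_real_derivative y t) (at t within {0..T})"
    by (rule has_field_derivative_transform_within[where d = 1]) (use t eq in auto)
  then show ?thesis using t by (simp add: y_def z)
qed

text \<open>Convergence of Riemann-Stieltjes sums of \<open>\<integral> f dB\<close> for a differentiable \<open>f\<close> and a merely continuous \<open>B\<close>, where the
limit is given by integration by parts. The antiderivative \<open>F\<close> stands for the integral of \<open>f' B\<close>, so that no
integral needs to be split at the grid points.\<close>

lemma left_Stieltjes_sums_tendsto:
  fixes f f' F B :: "real \<Rightarrow> real"
  assumes T: "0 < T" and B: "continuous_on {0..T} B"
    and f: "\<And>s. s \<in> {0..T} \<Longrightarrow> (f has_real_derivative f' s) (at s within {0..T})"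
    and F: "\<And>s. s \<in> {0..T} \<Longrightarrow> (F has_real_derivative f' s * B s) (at s within {0..T})"
    and L: "\<And>s. s \<in> {0..T} \<Longrightarrow> \<bar>f' s\<bar> \<le> L"
  shows "(\<lambda>n. \<Sum>k<n. f (real k * T / real n) * (B (real (Suc k) * T / real n) - B (real k * T / real n)))
     \<longlonglongrightarrow> f T * B T - f 0 * B 0 - (F T - F 0)"
proof (rule LIMSEQ_I)
  fix r :: real assume r: "0 < r"
  have L0: "L \<ge> 0" using L[of 0] T by auto
  define e where "e = r / (2 * (L + 1) * T)"
  have e: "e > 0" using r T L0 by (simp add: e_def)
  have "uniformly_continuous_on {0..T} B" using B by (intro compact_uniformly_continuous) auto
  then obtain d where d: "d > 0"
    "\<And>s s'. s \<in> {0..T} \<Longrightarrow> s' \<in> {0..T} \<Longrightarrow> dist s' s < d \<Longrightarrow> dist (B s') (B s) < e"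
    using e unfolding uniformly_continuous_on_def by metis
  obtain n0 where n0: "real n0 > T / d" using reals_Archimedean2 by blast
  \<comment> \<open>Freezing \<open>B\<close> at the right endpoint leaves \<open>F - B b f\<close>, whose derivative
     \<open>f' (B - B b)\<close> is uniformly small on a short interval.\<close>
  have step: "\<bar>(F b - F a) - B b * (f b - f a)\<bar> \<le> L * e * (b - a)"
    if ab: "0 \<le> a" "a \<le> b" "b \<le> T" "b - a < d" for a b
  proof -
    have "norm ((F b - B b * f b) - (F a - B b * f a)) \<le> (L * e) * norm (b - a)"
    proof (rule field_differentiable_bound[where S = "{a..b}"])
      fix s assume s: "s \<in> {a..b}"
      have sub: "{a..b} \<subseteq> {0..T}" using ab by auto
      show "((\<lambda>s. F s - B b * f s) has_field_derivative (f' s * B s - B b * f' s)) (at s within {a..b})"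
        using s sub by (auto intro!: derivative_eq_intros DERIV_subset[OF f] DERIV_subset[OF F])
      have "\<bar>B s - B b\<bar> \<le> e"
        using d(2)[of b s] s ab by (auto simp: dist_real_def)
      then have "\<bar>f' s\<bar> * \<bar>B s - B b\<bar> \<le> L * e"
        using L[of s] s ab L0 by (intro mult_mono) auto
      then show "norm (f' s * B s - B b * f' s) \<le> L * e"
        by (simp add: abs_mult[symmetric] algebra_simps)
    qed (use ab in auto)
    then show ?thesis using ab by (simp add: algebra_simps)
  qed
  show "\<exists>no. \<forall>n\<ge>no. norm ((\<Sum>k<n. f (real k * T / real n) * (B (real (Suc k) * T / real n) - B (real k * T / real n)))
      - (f T * B T - f 0 * B 0 - (F T - F 0))) < r"
  proof (intro exI allI impI)
    fix n assume n: "n \<ge> Suc n0"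
    define t where "t k = real k * T / real n" for k
    have n1: "real n > 0" "real n > T / d" using n n0 by auto
    have t: "t 0 = 0" "t n = T" using n1 by (auto simp: t_def)
    have tT: "0 \<le> t k" "t k \<le> t (Suc k)" "t (Suc k) - t k = T / real n" for k
      using T n1 by (auto simp: t_def field_simps)
    have tS: "t (Suc k) \<le> T" if "k < n" for k
    proof -
      have "real (Suc k) * T \<le> real n * T" using that T by (intro mult_right_mono) auto
      then show ?thesis using n1 by (simp add: t_def field_simps)
    qed
    have small: "T / real n < d" using n1 d(1) by (simp add: field_simps)
    \<comment> \<open>Summation by parts moves the differences from \<open>B\<close> to \<open>f\<close>.\<close>
    have abel: "(\<Sum>k<n. f (t k) * (B (t (Suc k)) - B (t k)))
       = (f T * B T - f 0 * B 0) - (\<Sum>k<n. B (t (Suc k)) * (f (t (Suc k)) - f (t k)))"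
    proof -
      have "f T * B T - f 0 * B 0 = (\<Sum>k<n. f (t (Suc k)) * B (t (Suc k)) - f (t k) * B (t k))"
        using sum_lessThan_telescope[of "\<lambda>k. f (t k) * B (t k)" n] t by simp
      then show ?thesis
        by (simp add: sum_subtractf[symmetric] algebra_simps)
    qed
    have tel: "F T - F 0 = (\<Sum>k<n. F (t (Suc k)) - F (t k))"
      using sum_lessThan_telescope[of "\<lambda>k. F (t k)" n] t by simp
    have "\<bar>(\<Sum>k<n. f (t k) * (B (t (Suc k)) - B (t k))) - (f T * B T - f 0 * B 0 - (F T - F 0))\<bar>
        = \<bar>\<Sum>k<n. (F (t (Suc k)) - F (t k)) - B (t (Suc k)) * (f (t (Suc k)) - f (t k))\<bar>"
      unfolding abel tel by (simp add: sum_subtractf)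
    also have "\<dots> \<le> (\<Sum>k<n. \<bar>(F (t (Suc k)) - F (t k)) - B (t (Suc k)) * (f (t (Suc k)) - f (t k))\<bar>)"
      by (rule sum_abs)
    also have "\<dots> \<le> (\<Sum>k<n. L * e * (t (Suc k) - t k))"
      by (intro sum_mono step) (use tT tS small in auto)
    also have "\<dots> = L * e * T"
      using sum_lessThan_telescope[of t n] t by (simp add: sum_distrib_left[symmetric])
    also have "\<dots> < r"
    proof -
      have "L * e * T = r * (L / (2 * (L + 1)))" using T by (simp add: e_def)
      also have "\<dots> < r * 1" using r L0 by (intro mult_strict_left_mono) (auto simp: field_simps)
      finally show ?thesis by simp
    qed
    finally show "norm ((\<Sum>k<n. f (real k * T / real n) * (B (real (Suc k) * T / real n) - B (real k * T / real n)))
      - (f T * B T - f 0 * B 0 - (F T - F 0))) < r"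
      by (simp add: t_def)
  qed
qed

text \<open>The limit of the variances of the approximating sums. This is a left sum with integrator \<open>B(s) = s\<close>, so the
convergence of Stieltjes sums applies once more.\<close>

lemma exp_left_sums:
  assumes T: "0 < T" and l: "0 < l"
  shows "(\<lambda>n. \<Sum>k<n. (exp (- l * (T - real k * T / real n)))\<^sup>2 * (real (Suc k) * T / real n - real k * T / real n))
    \<longlonglongrightarrow> (1 - exp (- 2 * l * T)) / (2 * l)"
proof -
  define f where "f s = exp (- 2 * l * (T - s))" for s
  have "(\<lambda>n. \<Sum>k<n. f (real k * T / real n) * (real (Suc k) * T / real n - real k * T / real n))
     \<longlonglongrightarrow> f T * T - f 0 * 0 - ((T * f T - f T / (2 * l)) - (0 * f 0 - f 0 / (2 * l)))"
  proof (rule left_Stieltjes_sums_tendsto[where f' = "\<lambda>s. 2 * l * f s" and L = "2 * l" and B = "\<lambda>s. s"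
        and F = "\<lambda>s. s * f s - f s / (2 * l)"])
    fix s assume s: "s \<in> {0..T}"
    show D: "(f has_real_derivative 2 * l * f s) (at s within {0..T})"
      unfolding f_def[abs_def] by (auto intro!: derivative_eq_intros)
    show "((\<lambda>s. s * f s - f s / (2 * l)) has_real_derivative 2 * l * f s * s) (at s within {0..T})"
      using l by (auto intro!: derivative_eq_intros D)
    have "f s \<le> 1" using s l by (simp add: f_def)
    moreover have "f s \<ge> 0" by (simp add: f_def)
    ultimately show "\<bar>2 * l * f s\<bar> \<le> 2 * l" using l by (simp add: abs_mult)
  qed (use T in auto)
  moreover have "(exp (- l * (T - s)))\<^sup>2 = f s" for s
    by (simp add: f_def power2_eq_square flip: exp_add)
  moreover have "f T * T - f 0 * 0 - ((T * f T - f T / (2 * l)) - (0 * f 0 - f 0 / (2 * l)))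
     = (1 - exp (- 2 * l * T)) / (2 * l)"
    using l by (simp add: f_def diff_divide_distrib)
  ultimately show ?thesis by simp
qed

text \<open>Variation of constants in the form of a Stieltjes integral: the right-hand side of the equation at time \<open>T\<close> is
\<open>\<integral> exp(-l(T-s)) db(s)\<close> over \<open>[0,T]\<close>. The integral of \<open>x\<close>, multiplied by the exponential, is the antiderivative
that the convergence of Stieltjes sums asks for, because the product rule cancels the linear term.\<close>

lemma linear_equation_left_sums:
  fixes x b :: "real \<Rightarrow> real"
  assumes T: "0 < T" and l: "0 < l"
    and b: "continuous_on {0..T} b" and b0: "b 0 = 0" and x: "set_integrable lborel {0..T} x"
    and ae: "AE s in lborel. s \<in> {0..T} \<longrightarrow> x s = b s - l * (LINT r:{0..s}|lborel. x r)"
  shows "(\<lambda>n. \<Sum>k<n. exp (- l * (T - real k * T / real n)) *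
      (b (real (Suc k) * T / real n) - b (real k * T / real n)))
    \<longlonglongrightarrow> b T - l * (LINT r:{0..T}|lborel. x r)"
proof -
  define z where "z t = (LINT r:{0..t}|lborel. x r)" for t
  define f where "f s = exp (- l * (T - s))" for s
  have "(\<lambda>n. \<Sum>k<n. f (real k * T / real n) * (b (real (Suc k) * T / real n) - b (real k * T / real n)))
    \<longlonglongrightarrow> f T * b T - f 0 * b 0 - (l * f T * z T - l * f 0 * z 0)"
  proof (rule left_Stieltjes_sums_tendsto[where f' = "\<lambda>s. l * f s" and L = l and F = "\<lambda>s. l * f s * z s"])
    fix s assume s: "s \<in> {0..T}"
    show D: "(f has_real_derivative l * f s) (at s within {0..T})"
      unfolding f_def[abs_def] by (auto intro!: derivative_eq_intros)
    have z: "(z has_real_derivative b s - l * z s) (at s within {0..T})"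
      unfolding z_def[abs_def] using T s by (intro linear_equation_integral_DERIV b x ae) auto
    show "((\<lambda>s. l * f s * z s) has_real_derivative l * f s * b s) (at s within {0..T})"
      by (auto intro!: derivative_eq_intros D z simp: algebra_simps)
    have "f s \<le> 1" using s l by (simp add: f_def)
    moreover have "f s \<ge> 0" by (simp add: f_def)
    ultimately show "\<bar>l * f s\<bar> \<le> l" using l by (simp add: abs_mult)
  qed (use T b in auto)
  moreover have "z 0 = 0"
  proof -
    have "set_integrable lborel {0..0} x" using T by (intro set_integrable_subset[OF x]) auto
    then show ?thesis by (simp add: z_def set_borel_integral_eq_integral(2))
  qed
  ultimately show ?thesis by (simp add: f_def b0 z_def)
qed

section \<open>The modes of the solution\<close>

text \<open>Rounding the time down to a grid turns the process into one with countably many times, which is jointly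
measurable; continuity of the paths lets the grid be refined.\<close>

lemma continuous_process_jointly_measurable:
  fixes B :: "real \<Rightarrow> 'w \<Rightarrow> real"
  assumes B: "\<And>t. B t \<in> borel_measurable M"
    and c: "\<And>\<omega>. \<omega> \<in> space M \<Longrightarrow> continuous_on UNIV (\<lambda>t. B t \<omega>)"
  shows "(\<lambda>p. B (fst p) (snd p)) \<in> borel_measurable (lborel \<Otimes>\<^sub>M M)"
proof (rule borel_measurable_LIMSEQ_real)
  define d where "d n t = real_of_int \<lfloor>real (Suc n) * t\<rfloor> / real (Suc n)" for n t
  fix p :: "real \<times> 'w" assume p: "p \<in> space (lborel \<Otimes>\<^sub>M M)"
  have "(\<lambda>n. d n (fst p)) \<longlonglongrightarrow> fst p"
  proof (rule tendsto_sandwich)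
    show "\<forall>\<^sub>F n in sequentially. fst p - 1 / real (Suc n) \<le> d n (fst p)"
    proof (rule always_eventually, rule allI)
      fix n
      have "fst p - 1 / real (Suc n) = (real (Suc n) * fst p - 1) / real (Suc n)"
        by (simp add: diff_divide_distrib del: of_nat_Suc)
      also have "\<dots> \<le> d n (fst p)"
        unfolding d_def by (intro divide_right_mono) linarith+
      finally show "fst p - 1 / real (Suc n) \<le> d n (fst p)" .
    qed
    show "\<forall>\<^sub>F n in sequentially. d n (fst p) \<le> fst p"
    proof (rule always_eventually, rule allI)
      fix n
      have "d n (fst p) \<le> real (Suc n) * fst p / real (Suc n)"
        unfolding d_def by (intro divide_right_mono) linarith+
      then show "d n (fst p) \<le> fst p" by (simp del: of_nat_Suc)
    qed
    have "(\<lambda>n. fst p - 1 / real (Suc n)) \<longlonglongrightarrow> fst p - 0"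
      by (intro tendsto_intros LIMSEQ_Suc[OF lim_1_over_n])
    then show "(\<lambda>n. fst p - 1 / real (Suc n)) \<longlonglongrightarrow> fst p" by simp
  qed simp
  moreover have "isCont (\<lambda>t. B t (snd p)) (fst p)"
    using c[of "snd p"] p by (auto simp: space_pair_measure continuous_on_eq_continuous_at)
  ultimately show "(\<lambda>n. B (d n (fst p)) (snd p)) \<longlonglongrightarrow> B (fst p) (snd p)"
    by (rule isCont_tendsto_compose[rotated])
next
  fix n
  note B[measurable]
  have "(\<lambda>p. \<lfloor>real (Suc n) * fst p\<rfloor>) \<in> measurable (lborel \<Otimes>\<^sub>M M) (count_space UNIV)"
    by measurable
  then show "(\<lambda>p. B (real_of_int \<lfloor>real (Suc n) * fst p\<rfloor> / real (Suc n)) (snd p)) \<in> borel_measurable (lborel \<Otimes>\<^sub>M M)"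
    by (rule measurable_compose_countable[rotated]) measurable
qed

lemma lam_pos: "m \<ge> 1 \<Longrightarrow> lam m > 0"
  by (simp add: lam_def)

lemma cylindrical_BM_measurable:
  "cylindrical_BM M W \<Longrightarrow> t \<ge> 0 \<Longrightarrow> g \<in> L2 \<Longrightarrow> W t g \<in> borel_measurable M"
  by (simp add: cylindrical_BM_def)

lemma cylindrical_BM_at_0:
  assumes W: "cylindrical_BM M W" and g: "g \<in> L2"
  shows "AE \<omega> in M. W 0 g \<omega> = 0"
proof -
  note m [measurable] = cylindrical_BM_measurable[OF W order.refl g]
  have "distr M borel (W 0 g) = centered_normal 0"
    using cylindrical_BM_linear_combination[OF W, of 1 "\<lambda>_. 0" "\<lambda>_. g" "\<lambda>_. 1"] g by simp
  then have "(\<integral>\<^sup>+\<omega>. ennreal ((W 0 g \<omega>)\<^sup>2) \<partial>M) = ennreal 0"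
    using m by (intro second_moment_of_centered_normal) auto
  then have "AE \<omega> in M. ennreal ((W 0 g \<omega>)\<^sup>2) = 0"
    by (subst (asm) ennreal_0, subst (asm) nn_integral_0_iff_AE) auto
  then show ?thesis by eventually_elim simp
qed

text \<open>The solution is given on \<open>[0,T]\<close> only. Clamping the time to this interval extends it to a process on the whole
line, where Lebesgue measure and Fubini's theorem are at hand.\<close>

lemma heat_solution_mode_measurable:
  assumes X: "heat_solution M W T X" and T: "0 < T" and g: "g \<in> L2"
  shows "(\<lambda>p. L2_inner (X (max 0 (min T (fst p))) (snd p)) g) \<in> borel_measurable (lborel \<Otimes>\<^sub>M M)"
    and "(\<lambda>\<omega>. L2_inner (X T \<omega>) g) \<in> borel_measurable M"
proof -
  have X': "(\<lambda>(t, \<omega>). X t \<omega>) \<in> (restrict_space borel {0..T} \<Otimes>\<^sub>M M) \<rightarrow>\<^sub>M L2_borel"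
    using X by (simp add: heat_solution_def)
  have cl: "(\<lambda>s. max 0 (min T s)) \<in> lborel \<rightarrow>\<^sub>M restrict_space borel {0..T}"
    using T by (intro measurable_restrict_space2) auto
  have "(\<lambda>p. (max 0 (min T (fst p)), snd p)) \<in> (lborel \<Otimes>\<^sub>M M) \<rightarrow>\<^sub>M (restrict_space borel {0..T} \<Otimes>\<^sub>M M)"
    by (intro measurable_Pair measurable_compose[OF measurable_fst cl] measurable_snd)
  from measurable_compose[OF measurable_compose[OF this X'] L2_inner_measurable[OF g]]
  show *: "(\<lambda>p. L2_inner (X (max 0 (min T (fst p))) (snd p)) g) \<in> borel_measurable (lborel \<Otimes>\<^sub>M M)"
    by simp
  have "(\<lambda>\<omega>. (T, \<omega>)) \<in> M \<rightarrow>\<^sub>M lborel \<Otimes>\<^sub>M M" by (intro measurable_Pair) auto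
  from measurable_compose[OF this *] show "(\<lambda>\<omega>. L2_inner (X T \<omega>) g) \<in> borel_measurable M"
    using T by simp
qed

lemma L2_inner_sin_basis_half_deriv2:
  "L2_inner u (\<lambda>x. 1/2 * (- 2 * lam m * sin_basis m x)) = - lam m * L2_inner u (sin_basis m)"
  unfolding L2_inner_def by (subst integral_mult_right_zero[symmetric]) (simp add: mult_ac)

lemma heat_solution_mode_equation:
  assumes X: "heat_solution M W T X" and m: "m \<ge> 1" and t: "t \<in> {0..T}"
  shows "AE \<omega> in M. set_integrable lborel {0..t} (\<lambda>s. L2_inner (X s \<omega>) (sin_basis m)) \<and>
     L2_inner (X t \<omega>) (sin_basis m) =
       W t (sin_basis m) \<omega> - lam m * (LINT s:{0..t}|lborel. L2_inner (X s \<omega>) (sin_basis m))"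
proof -
  have "AE \<omega> in M.
          set_integrable lborel {0..t} (\<lambda>s. L2_inner (X s \<omega>) (\<lambda>x. 1/2 * (- 2 * lam m * sin_basis m x))) \<and>
          L2_inner (X t \<omega>) (sin_basis m) =
            (LINT s:{0..t}|lborel. L2_inner (X s \<omega>) (\<lambda>x. 1/2 * (- 2 * lam m * sin_basis m x))) + W t (sin_basis m) \<omega>"
    using X sin_basis_test_function[OF m] weak_deriv2_sin_basis[of m] t
    unfolding heat_solution_def by blast
  then show ?thesis
    unfolding L2_inner_sin_basis_half_deriv2
  proof eventually_elim
    case (elim \<omega>)
    have "set_integrable lborel {0..t} (\<lambda>s. (- 1 / lam m) * (- lam m * L2_inner (X s \<omega>) (sin_basis m)))"
      by (rule set_integrable_mult_right) (use elim in blast)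
    moreover have "(- 1 / lam m) * (- lam m * c) = c" for c
      using lam_pos[OF m] by simp
    ultimately have "set_integrable lborel {0..t} (\<lambda>s. L2_inner (X s \<omega>) (sin_basis m))"
      by (simp only:)
    moreover have "(LINT s:{0..t}|lborel. - lam m * L2_inner (X s \<omega>) (sin_basis m)) =
      - lam m * (LINT s:{0..t}|lborel. L2_inner (X s \<omega>) (sin_basis m))"
      by (rule set_integral_mult_right)
    ultimately show ?case using elim by linarith
  qed
qed

text \<open>The scalar equation is made pathwise with Fubini's theorem. The almost sure limit that results expresses the
coefficient through increments of one Brownian motion, and its law is the limit of their laws.\<close>

lemma heat_solution_mode_distribution:
  assumes "prob_space M" and T: "0 < T" and W: "cylindrical_BM M W"
    and X: "heat_solution M W T X" and m: "m \<ge> 1"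
  shows "distr M borel (\<lambda>\<omega>. L2_inner (X T \<omega>) (sin_basis m)) =
    centered_normal ((1 - exp (- 2 * lam m * T)) / (2 * lam m))"
proof -
  interpret prob_space M by fact
  interpret P: pair_sigma_finite lborel M ..
  define e where "e = sin_basis m"
  define l where "l = lam m"
  have l: "l > 0" using lam_pos[OF m] by (simp add: l_def)
  have e: "e \<in> L2" "L2_inner e e = 1"
    using sin_basis_in_L2 L2_inner_sin_basis_self[OF m] by (auto simp: e_def)
  define x where "x s \<omega> = L2_inner (X (max 0 (min T s)) \<omega>) e" for s \<omega>
  have x [measurable]: "(\<lambda>p. x (fst p) (snd p)) \<in> borel_measurable (lborel \<Otimes>\<^sub>M M)"
    unfolding x_def by (rule heat_solution_mode_measurable[OF X T e(1)])
  have "AE \<omega> in M. continuous_on {0..} (\<lambda>t. W t e \<omega>)"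
    using W e by (simp add: cylindrical_BM_def)
  then obtain N where N: "N \<in> null_sets M" "{\<omega> \<in> space M. \<not> continuous_on {0..} (\<lambda>t. W t e \<omega>)} \<subseteq> N"
    unfolding eventually_ae_filter by auto
  \<comment> \<open>Fubini's theorem asks for joint measurability. It holds for a version of the Brownian motion
     whose paths are all continuous, extended by a constant to negative times.\<close>
  define B where "B t \<omega> = (if \<omega> \<in> N then 0 else W (max 0 t) e \<omega>)" for t \<omega>
  have Wm: "W t e \<in> borel_measurable M" if "t \<ge> 0" for t
    using cylindrical_BM_measurable[OF W that e(1)] .
  have Bm: "B t \<in> borel_measurable M" for t
    using N(1) unfolding B_def[abs_def] by (intro measurable_If_set Wm) auto
  have Bc: "continuous_on UNIV (\<lambda>t. B t \<omega>)" if "\<omega> \<in> space M" for \<omega>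
  proof (cases "\<omega> \<in> N")
    case False
    then have "continuous_on {0..} (\<lambda>t. W t e \<omega>)" using N(2) that by auto
    then have "continuous_on UNIV (\<lambda>t. W (max 0 t) e \<omega>)"
      by (rule continuous_on_compose2) (auto intro!: continuous_intros)
    then show ?thesis using False by (simp add: B_def)
  qed (simp add: B_def)
  have BW: "AE \<omega> in M. \<forall>t\<ge>0. B t \<omega> = W t e \<omega>"
    using AE_not_in[OF N(1)] by eventually_elim (auto simp: B_def max_def)
  have [measurable]: "(\<lambda>p. B (fst p) (snd p)) \<in> borel_measurable (lborel \<Otimes>\<^sub>M M)"
    by (rule continuous_process_jointly_measurable[OF Bm Bc])

  define P where "P s \<omega> \<longleftrightarrow> s \<in> {0..T} \<longrightarrow> x s \<omega> = B s \<omega> - l * (LINT r:{0..s}|lborel. x r \<omega>)" for s \<omega>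
  have eqn: "AE \<omega> in M. set_integrable lborel {0..s} (\<lambda>r. x r \<omega>) \<and> P s \<omega>" if s: "s \<in> {0..T}" for s
    using heat_solution_mode_equation[OF X m s] BW
  proof eventually_elim
    case (elim \<omega>)
    have eq: "L2_inner (X r \<omega>) e = x r \<omega>" if "r \<in> {0..s}" for r
      using that s by (simp add: x_def)
    have "set_integrable lborel {0..s} (\<lambda>r. L2_inner (X r \<omega>) e) \<longleftrightarrow> set_integrable lborel {0..s} (\<lambda>r. x r \<omega>)"
      by (rule set_integrable_cong) (auto simp: eq)
    moreover have "(LINT r:{0..s}|lborel. L2_inner (X r \<omega>) e) = (LINT r:{0..s}|lborel. x r \<omega>)"
      by (rule set_lebesgue_integral_cong) (auto simp: eq)
    ultimately show ?case
      using elim s eq[of s] by (simp add: P_def e_def[symmetric] l_def[symmetric])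
  qed
  have "AE \<omega> in M. AE s in lborel. P s \<omega>"
  proof (subst P.AE_commute[symmetric])
    have "(\<lambda>q. x (snd q) (snd (fst q))) \<in> borel_measurable ((lborel \<Otimes>\<^sub>M M) \<Otimes>\<^sub>M lborel)"
      using measurable_compose[of "\<lambda>q. (snd q, snd (fst q))" "(lborel \<Otimes>\<^sub>M M) \<Otimes>\<^sub>M lborel" "lborel \<Otimes>\<^sub>M M", OF _ x]
      by simp
    note [measurable] = this
    have "(\<lambda>p. LINT r|lborel. (if 0 \<le> r \<and> r \<le> fst p then x r (snd p) else 0)) \<in> borel_measurable (lborel \<Otimes>\<^sub>M M)"
      by (rule lborel.borel_measurable_lebesgue_integral) (simp add: case_prod_beta')
    moreover have "(LINT r:{0..s}|lborel. x r \<omega>) = (LINT r|lborel. (if 0 \<le> r \<and> r \<le> s then x r \<omega> else 0))" for s \<omega>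
      unfolding set_lebesgue_integral_def by (intro Bochner_Integration.integral_cong) (auto simp: indicator_def)
    ultimately have [measurable]: "(\<lambda>p. LINT r:{0..fst p}|lborel. x r (snd p)) \<in> borel_measurable (lborel \<Otimes>\<^sub>M M)"
      by simp
    show "{p \<in> space (lborel \<Otimes>\<^sub>M M). P (fst p) (snd p)} \<in> sets (lborel \<Otimes>\<^sub>M M)"
      unfolding P_def by measurable
    show "AE s in lborel. AE \<omega> in M. P s \<omega>"
    proof (rule AE_I2)
      fix s show "AE \<omega> in M. P s \<omega>"
        by (cases "s \<in> {0..T}") (use eqn[of s] in \<open>auto simp: P_def\<close>)
    qed
  qed
  moreover have "AE \<omega> in M. set_integrable lborel {0..T} (\<lambda>r. x r \<omega>) \<and> P T \<omega>"
    using T by (intro eqn) auto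
  moreover note cylindrical_BM_at_0[OF W e(1)] BW AE_space
  ultimately have lim: "AE \<omega> in M. (\<lambda>n. \<Sum>k<n. exp (- l * (T - real k * T / real n)) *
      (W (real (Suc k) * T / real n) e \<omega> - W (real k * T / real n) e \<omega>)) \<longlonglongrightarrow> L2_inner (X T \<omega>) e"
  proof eventually_elim
    case (elim \<omega>)
    have "(\<lambda>n. \<Sum>k<n. exp (- l * (T - real k * T / real n)) *
      (B (real (Suc k) * T / real n) \<omega> - B (real k * T / real n) \<omega>))
      \<longlonglongrightarrow> B T \<omega> - l * (LINT r:{0..T}|lborel. x r \<omega>)"
      using elim T l continuous_on_subset[OF Bc] by (intro linear_equation_left_sums) (auto simp: P_def)
    moreover have "B T \<omega> - l * (LINT r:{0..T}|lborel. x r \<omega>) = L2_inner (X T \<omega>) e"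
      using elim T by (simp add: P_def x_def)
    ultimately show ?case using elim T by simp
  qed
  have "distr M borel (\<lambda>\<omega>. L2_inner (X T \<omega>) e) = centered_normal ((1 - exp (- 2 * l * T)) / (2 * l))"
  proof (rule centered_normal_limit[OF \<open>prob_space M\<close> _ _ lim])
    show "(\<lambda>\<omega>. L2_inner (X T \<omega>) e) \<in> borel_measurable M"
      by (rule heat_solution_mode_measurable(2)[OF X T e(1)])
    show "(\<lambda>\<omega>. \<Sum>k<n. exp (- l * (T - real k * T / real n)) *
      (W (real (Suc k) * T / real n) e \<omega> - W (real k * T / real n) e \<omega>)) \<in> borel_measurable M" for n
      using T by (intro borel_measurable_sum borel_measurable_times borel_measurable_diff Wm borel_measurable_const) auto
    show "distr M borel (\<lambda>\<omega>. \<Sum>k<n. exp (- l * (T - real k * T / real n)) *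
      (W (real (Suc k) * T / real n) e \<omega> - W (real k * T / real n) e \<omega>)) =
      centered_normal (\<Sum>k<n. (exp (- l * (T - real k * T / real n)))\<^sup>2 *
        (real (Suc k) * T / real n - real k * T / real n))" for n
      using T by (intro cylindrical_BM_increments[OF W e, where t = "\<lambda>k. real k * T / real n"] monoI)
        (auto intro!: divide_right_mono mult_right_mono)
    have "real k * T / real n \<le> real (Suc k) * T / real n" for k n
      using T by (intro divide_right_mono mult_right_mono) auto
    then show "0 \<le> (\<Sum>k<n. (exp (- l * (T - real k * T / real n)))\<^sup>2 *
        (real (Suc k) * T / real n - real k * T / real n))" for n
      by (intro sum_nonneg mult_nonneg_nonneg) simp_all
    show "(\<lambda>n. \<Sum>k<n. (exp (- l * (T - real k * T / real n)))\<^sup>2 *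
        (real (Suc k) * T / real n - real k * T / real n)) \<longlonglongrightarrow> (1 - exp (- 2 * l * T)) / (2 * l)"
      by (rule exp_left_sums[OF T l])
  qed
  then show ?thesis by (simp add: e_def l_def)
qed

section \<open>The modes of the Euler scheme\<close>

lemma implicit_euler_mode_equation:
  assumes Y: "implicit_euler M W T N Y" and m: "m \<ge> 1" and k: "k < N"
  shows "AE \<omega> in M. L2_inner (Y (Suc k) \<omega>) (sin_basis m) = L2_inner (Y k \<omega>) (sin_basis m)
     - T / real N * lam m * L2_inner (Y (Suc k) \<omega>) (sin_basis m)
     + (W (real (Suc k) * (T / real N)) (sin_basis m) \<omega> - W (real k * (T / real N)) (sin_basis m) \<omega>)"
proof -
  have "AE \<omega> in M. L2_inner (Y (Suc k) \<omega>) (sin_basis m) = L2_inner (Y k \<omega>) (sin_basis m)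
     + T / real N * L2_inner (Y (Suc k) \<omega>) (\<lambda>x. 1/2 * (- 2 * lam m * sin_basis m x))
     + (W (real (Suc k) * (T / real N)) (sin_basis m) \<omega> - W (real k * (T / real N)) (sin_basis m) \<omega>)"
    using Y sin_basis_test_function[OF m] weak_deriv2_sin_basis[of m] k
    unfolding implicit_euler_def Let_def by blast
  then show ?thesis
    unfolding L2_inner_sin_basis_half_deriv2 by eventually_elim simp
qed

lemma implicit_euler_mode_measurable:
  assumes Y: "implicit_euler M W T N Y" and k: "k \<le> N" and g: "g \<in> L2"
  shows "(\<lambda>\<omega>. L2_inner (Y k \<omega>) g) \<in> borel_measurable M"
  using Y k unfolding implicit_euler_def Let_def
  by (intro measurable_compose[OF _ L2_inner_measurable[OF g]]) blast

text \<open>The recursion is solved by the discrete analogue of the variation of constants formula, and the variance of the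
sum of weighted increments is a geometric sum.\<close>

lemma implicit_euler_mode_second_moment:
  assumes T: "0 < T" and W: "cylindrical_BM M W"
    and Y: "implicit_euler M W T N Y" and m: "m \<ge> 1" and N: "N \<ge> 1"
  defines "h \<equiv> T / real N" and "l \<equiv> lam m"
  shows "(\<integral>\<^sup>+\<omega>. ennreal ((L2_inner (Y N \<omega>) (sin_basis m))\<^sup>2) \<partial>M) =
    ennreal ((1 - (1 / (1 + l * h)) ^ (2 * N)) / (2 * l + l\<^sup>2 * h))"
proof -
  define e where "e = sin_basis m"
  have l: "l > 0" using lam_pos[OF m] by (simp add: l_def)
  have h: "h > 0" using T N by (simp add: h_def)
  have e: "e \<in> L2" "L2_inner e e = 1"
    using sin_basis_in_L2 L2_inner_sin_basis_self[OF m] by (auto simp: e_def)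
  define q where "q = 1 / (1 + l * h)"
  have lh: "l * h > 0" using l h by simp
  have q: "q * (1 + l * h) = 1" "q > 0" using lh by (auto simp: q_def)
  define dW where "dW k \<omega> = W (real (Suc k) * h) e \<omega> - W (real k * h) e \<omega>" for k \<omega>
  define y where "y k \<omega> = L2_inner (Y k \<omega>) e" for k \<omega>
  have "AE \<omega> in M. y 0 \<omega> = 0"
  proof -
    have "AE \<omega> in M. AE x in unit_leb. Y 0 \<omega> x = 0"
      using Y unfolding implicit_euler_def Let_def by blast
    then show ?thesis
    proof eventually_elim
      case (elim \<omega>)
      then have "AE x in unit_leb. Y 0 \<omega> x * e x = 0" by eventually_elim simp
      then show ?case unfolding y_def L2_inner_def by (rule integral_eq_zero_AE)
    qed
  qed
  moreover have "AE \<omega> in M. \<forall>k\<in>{..<N}. y (Suc k) \<omega> = y k \<omega> - h * l * y (Suc k) \<omega> + dW k \<omega>"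
    using implicit_euler_mode_equation[OF Y m]
    by (intro AE_finite_allI) (auto simp: y_def dW_def h_def l_def e_def)
  ultimately have sol: "AE \<omega> in M. y N \<omega> = (\<Sum>j<N. q ^ (N - j) * dW j \<omega>)"
  proof eventually_elim
    case (elim \<omega>)
    have "k \<le> N \<Longrightarrow> y k \<omega> = (\<Sum>j<k. q ^ (k - j) * dW j \<omega>)" for k
    proof (induction k)
      case 0
      then show ?case using elim by simp
    next
      case (Suc k)
      have "(1 + l * h) * y (Suc k) \<omega> = y k \<omega> + dW k \<omega>"
        using elim(2) Suc.prems by (auto simp: algebra_simps)
      then have "q * (1 + l * h) * y (Suc k) \<omega> = q * (y k \<omega> + dW k \<omega>)"
        by (simp add: mult.assoc)
      then have "y (Suc k) \<omega> = q * (y k \<omega> + dW k \<omega>)" by (simp add: q)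
      also have "\<dots> = q * (\<Sum>j<k. q ^ (k - j) * dW j \<omega>) + q * dW k \<omega>"
        using Suc by (simp add: distrib_left)
      also have "\<dots> = (\<Sum>j<Suc k. q ^ (Suc k - j) * dW j \<omega>)"
        by (simp add: sum_distrib_left Suc_diff_le mult.assoc)
      finally show ?case .
    qed
    then show ?case by simp
  qed
  define v where "v = (\<Sum>j<N. (q ^ (N - j))\<^sup>2 * (real (Suc j) * h - real j * h))"
  have Wm: "W t e \<in> borel_measurable M" if "t \<ge> 0" for t
    using cylindrical_BM_measurable[OF W that e(1)] .
  have "distr M borel (\<lambda>\<omega>. \<Sum>j<N. q ^ (N - j) * dW j \<omega>) = centered_normal v"
    unfolding dW_def v_def using h
    by (intro cylindrical_BM_increments[OF W e, where t = "\<lambda>k. real k * h"] monoI) auto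
  moreover have "(\<lambda>\<omega>. \<Sum>j<N. q ^ (N - j) * dW j \<omega>) \<in> borel_measurable M"
    unfolding dW_def using h
    by (intro borel_measurable_sum borel_measurable_times borel_measurable_diff Wm borel_measurable_const) auto
  moreover have "v \<ge> 0" unfolding v_def using h by (intro sum_nonneg) (auto simp: algebra_simps)
  ultimately have "(\<integral>\<^sup>+\<omega>. ennreal ((\<Sum>j<N. q ^ (N - j) * dW j \<omega>)\<^sup>2) \<partial>M) = ennreal v"
    by (intro second_moment_of_centered_normal)
  moreover have "(\<integral>\<^sup>+\<omega>. ennreal ((\<Sum>j<N. q ^ (N - j) * dW j \<omega>)\<^sup>2) \<partial>M) = (\<integral>\<^sup>+\<omega>. ennreal ((y N \<omega>)\<^sup>2) \<partial>M)"
    using sol by (intro nn_integral_cong_AE) (auto elim: eventually_mono)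
  moreover have "v = (1 - q ^ (2 * N)) / (2 * l + l\<^sup>2 * h)"
  proof -
    have "v = (\<Sum>j<N. h * q\<^sup>2 * (q\<^sup>2) ^ (N - Suc j))"
      unfolding v_def
    proof (intro sum.cong refl)
      fix j assume "j \<in> {..<N}"
      then have "N - j = Suc (N - Suc j)" by auto
      then show "(q ^ (N - j))\<^sup>2 * (real (Suc j) * h - real j * h) = h * q\<^sup>2 * (q\<^sup>2) ^ (N - Suc j)"
        by (simp add: power_mult_distrib power2_eq_square algebra_simps)
    qed
    also have "\<dots> = h * q\<^sup>2 * (\<Sum>j<N. (q\<^sup>2) ^ j)"
      by (simp add: sum_distrib_left[symmetric] sum.nat_diff_reindex[of "\<lambda>j. (q\<^sup>2) ^ j"])
    finally have "(1 - q\<^sup>2) * v = h * q\<^sup>2 * ((1 - q\<^sup>2) * (\<Sum>j<N. (q\<^sup>2) ^ j))" by simp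
    then have 1: "(1 - q\<^sup>2) * v = h * q\<^sup>2 * (1 - q ^ (2 * N))"
      by (simp add: one_diff_power_eq[symmetric] power_mult)
    have "q\<^sup>2 * (1 + l * h)\<^sup>2 = 1" using q(1) by (metis power_mult_distrib power_one)
    then have "1 - q\<^sup>2 = q\<^sup>2 * ((1 + l * h)\<^sup>2 - 1)" by (simp add: right_diff_distrib)
    also have "\<dots> = q\<^sup>2 * h * (2 * l + l\<^sup>2 * h)" by (simp add: power2_eq_square algebra_simps)
    finally have "1 - q\<^sup>2 = q\<^sup>2 * h * (2 * l + l\<^sup>2 * h)" .
    with 1 have "(q\<^sup>2 * h) * ((2 * l + l\<^sup>2 * h) * v) = (q\<^sup>2 * h) * (1 - q ^ (2 * N))"
      by (simp add: mult_ac)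
    moreover have "q\<^sup>2 * h \<noteq> 0" using q h by simp
    ultimately have "(2 * l + l\<^sup>2 * h) * v = 1 - q ^ (2 * N)" by simp
    moreover have "2 * l + l\<^sup>2 * h > 0" using l h by (simp add: add_pos_pos)
    ultimately show ?thesis by (simp add: field_simps)
  qed
  ultimately show ?thesis by (simp add: y_def e_def q_def)
qed

section \<open>The error of a single mode and its sum over all modes\<close>

text \<open>A bound by \<open>x\<close> that does not grow with \<open>n\<close>: one step has an error of order \<open>x\<^sup>2\<close>, and the \<open>n\<close> steps sum up
to \<open>n x\<^sup>2 / (1 + x)\<^sup>n\<close>, where the damping \<open>(1 + x)\<^sup>n \<ge> 1 + n x\<close> absorbs the factor \<open>n x\<close>.\<close>

lemma resolvent_power_minus_exp:
  fixes x :: real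
  assumes x: "x \<ge> 0"
  shows "0 \<le> (1 / (1 + x)) ^ n - exp (- x) ^ n" "(1 / (1 + x)) ^ n - exp (- x) ^ n \<le> min 1 x"
proof -
  define A where "A = 1 / (1 + x)"
  have A: "0 < A" "A \<le> 1" "A * (1 + x) = 1" using x by (auto simp: A_def)
  have "exp (- x) \<le> A"
    using exp_ge_add_one_self[of x] x by (simp add: A_def exp_minus inverse_eq_divide frac_le)
  then show "0 \<le> (1 / (1 + x)) ^ n - exp (- x) ^ n"
    by (simp add: A_def power_mono)
  have "A ^ n - exp (- x) ^ n \<le> x"
  proof -
    \<comment> \<open>The quotient of the exact and the approximate propagator of one step.\<close>
    define y where "y = (1 + x) * exp (- x)"
    have "(1 + x) * (1 - x) \<le> y"
      unfolding y_def using x exp_ge_add_one_self[of "- x"] by (intro mult_left_mono) auto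
    then have y: "1 - y \<le> x\<^sup>2" by (simp add: power2_eq_square algebra_simps)
    have y0: "y \<ge> 0" using x by (simp add: y_def)
    have "1 + real n * (y - 1) \<le> y ^ n"
      using Bernoulli_inequality[of "y - 1" n] y0 by simp
    then have "1 - y ^ n \<le> real n * (1 - y)" by (simp add: algebra_simps)
    also have "\<dots> \<le> real n * x\<^sup>2" using y by (intro mult_left_mono) auto
    finally have "A ^ n * (1 - y ^ n) \<le> A ^ n * (real n * x\<^sup>2)"
      using A by (intro mult_left_mono) auto
    moreover have "A ^ n * y ^ n = exp (- x) ^ n"
      using A(3) by (simp add: y_def flip: power_mult_distrib mult.assoc)
    ultimately have "A ^ n - exp (- x) ^ n \<le> x * (A ^ n * (real n * x))"
      by (simp add: right_diff_distrib power2_eq_square mult_ac)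
    also have "A ^ n * (real n * x) \<le> A ^ n * (1 + x) ^ n"
      using Bernoulli_inequality[of x n] x A by (intro mult_left_mono) auto
    also have "A ^ n * (1 + x) ^ n = 1"
      using A(3) by (simp flip: power_mult_distrib)
    finally show ?thesis using x by (simp add: mult_left_mono)
  qed
  moreover have "A ^ n - exp (- x) ^ n \<le> 1"
  proof -
    have "A ^ n \<le> 1" using A by (intro power_le_one) auto
    moreover have "0 \<le> exp (- x) ^ n" by (intro zero_le_power) simp
    ultimately show ?thesis by linarith
  qed
  ultimately show "(1 / (1 + x)) ^ n - exp (- x) ^ n \<le> min 1 x" by (simp add: A_def)
qed

text \<open>There are two sources of error of the same size: the denominator \<open>2l + l\<^sup>2h\<close> in place of \<open>2l\<close>, and the power of
the resolvent in place of the exponential function. They have the same sign, and each is at most half of the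
bound.\<close>

lemma mode_variance_error:
  assumes l: "l > 0" and h: "h > 0" and T: "T = real N * h"
  shows "\<bar>(1 - (1 / (1 + l * h)) ^ (2 * N)) / (2 * l + l\<^sup>2 * h) - (1 - exp (- 2 * l * T)) / (2 * l)\<bar>
    \<le> min 1 (l * h) / l"
proof -
  define x where "x = l * h"
  have x: "x > 0" using l h by (simp add: x_def)
  define a b where "a = (1 / (1 + x)) ^ (2 * N)" and "b = exp (- x) ^ (2 * N)"
  have ab: "0 \<le> a - b" "a - b \<le> min 1 x"
    using resolvent_power_minus_exp[of x "2 * N"] x by (auto simp: a_def b_def)
  have a: "0 \<le> a" "a \<le> 1" using x by (auto simp: a_def intro!: power_le_one)
  have b: "exp (- 2 * l * T) = b"
    unfolding b_def T by (simp add: x_def mult_ac flip: exp_of_nat_mult)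
  \<comment> \<open>The part of the error that is due to the denominator, multiplied by \<open>2 * l\<close>.\<close>
  define d where "d = (1 - a) * (x / (2 + x))"
  have "x / (2 + x) \<le> min 1 x" using x by (auto simp: field_simps)
  then have "d \<le> 1 * min 1 x"
    unfolding d_def using a x by (intro mult_mono) auto
  moreover have "0 \<le> d" unfolding d_def using a x by simp
  ultimately have d: "0 \<le> d" "d \<le> min 1 x" by simp_all
  have "(1 - a) / (2 * l + l\<^sup>2 * h) = (1 - a) / (l * (2 + x))"
    by (simp add: x_def power2_eq_square algebra_simps)
  also have "\<dots> = ((1 - a) - d) / (2 * l)"
  proof -
    have "(1 - a) - d = (1 - a) * (2 / (2 + x))"
      using x by (simp add: d_def field_simps)
    moreover have "c / (l * (2 + x)) = c * (2 / (2 + x)) / (2 * l)" for c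
      using l x by (simp add: divide_simps)
    ultimately show ?thesis by (simp only:)
  qed
  finally have "(1 - a) / (2 * l + l\<^sup>2 * h) - (1 - b) / (2 * l) = - (d + (a - b)) / (2 * l)"
    by (simp add: diff_divide_distrib add_divide_distrib)
  then have "\<bar>(1 - a) / (2 * l + l\<^sup>2 * h) - (1 - b) / (2 * l)\<bar> = (d + (a - b)) / (2 * l)"
    using l d(1) ab(1) by (simp add: abs_of_nonneg)
  also have "\<dots> \<le> (2 * min 1 x) / (2 * l)"
    using l d(2) ab(2) by (intro divide_right_mono) auto
  finally show ?thesis unfolding b by (simp add: a_def x_def)
qed

text \<open>Each term is compared with the increment of \<open>t powr s / s\<close>, which dominates it
since \<open>t powr (s - 1)\<close> does not increase.\<close>

lemma sum_powr_le:
  fixes s :: real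
  assumes s: "0 < s" "s \<le> 1"
  shows "(\<Sum>m<K. real (Suc m) powr (s - 1)) \<le> real K powr s / s"
proof (induction K)
  case (Suc K)
  have "s * real (Suc K) powr (s - 1) \<le> real (Suc K) powr s - real K powr s"
  proof (cases "K = 0")
    case False
    have "\<exists>z>real K. z < real (Suc K) \<and> real (Suc K) powr s - real K powr s = (real (Suc K) - real K) * (s * z powr (s - 1))"
      using False by (intro MVT2) (auto intro!: derivative_eq_intros)
    then obtain z where z: "real K < z" "z < real (Suc K)" "real (Suc K) powr s - real K powr s = s * z powr (s - 1)"
      by auto
    have "real (Suc K) powr (s - 1) \<le> z powr (s - 1)"
      using z s False by (intro powr_mono2') auto
    then show ?thesis using z(3) s by simp
  qed (use s in simp)
  then have "real (Suc K) powr (s - 1) \<le> (real (Suc K) powr s - real K powr s) / s"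
    using s by (simp add: pos_le_divide_eq mult.commute)
  then show ?case using Suc by (simp add: diff_divide_distrib)
qed simp

text \<open>The same comparison with a decreasing power. Since \<open>r \<ge> 1\<close>, the factor \<open>1/r\<close> in the primitive can be
omitted.\<close>

lemma sum_powr_tail_le:
  fixes r :: real
  assumes r: "1 \<le> r" and K: "1 \<le> K" "K \<le> M"
  shows "(\<Sum>m\<in>{K..<M}. real (Suc m) powr (- r - 1)) \<le> real K powr (- r) - real M powr (- r)"
  using K(2)
proof (induction M rule: dec_induct)
  case (step M)
  have "\<exists>z>real M. z < real (Suc M) \<and> real (Suc M) powr (- r) - real M powr (- r) = (real (Suc M) - real M) * (- r * z powr (- r - 1))"
    using step K by (intro MVT2) (auto intro!: derivative_eq_intros)
  then obtain z where z: "real M < z" "z < real (Suc M)"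
     "real M powr (- r) - real (Suc M) powr (- r) = r * z powr (- r - 1)"
    by auto
  have "1 * real (Suc M) powr (- r - 1) \<le> r * z powr (- r - 1)"
    using z r step K by (intro mult_mono powr_mono2') auto
  then show ?case using step z(3) by simp
qed simp

lemma lam_ge: "(real m)\<^sup>2 \<le> lam m"
proof -
  have "2\<^sup>2 \<le> pi\<^sup>2" using pi_ge_two by (intro power_mono) auto
  then have "2 * (real m)\<^sup>2 \<le> pi\<^sup>2 * (real m)\<^sup>2" by (intro mult_right_mono) auto
  then show ?thesis by (simp add: lam_def power_mult_distrib)
qed

lemma lam_powr_le:
  assumes "m \<ge> 1" "p \<ge> 0"
  shows "lam m powr (- p) \<le> real m powr (- 2 * p)"
proof -
  have "lam m powr (- p) \<le> ((real m)\<^sup>2) powr (- p)"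
    using assms lam_ge by (intro powr_mono2') auto
  also have "(real m)\<^sup>2 = real m powr 2" using assms by (simp add: powr_numeral)
  also have "(real m powr 2) powr (- p) = real m powr (- 2 * p)" unfolding powr_powr by simp
  finally show ?thesis .
qed

lemma lam_powr_div_le:
  assumes "m \<ge> 1" "p \<ge> 0"
  shows "lam m powr (- p) / lam m \<le> real m powr (- (1 + 2 * p) - 1)"
proof -
  have "lam m powr (- p) / lam m \<le> real m powr (- 2 * p) / (real m)\<^sup>2"
    using lam_powr_le[OF assms] lam_ge[of m] assms by (intro frac_le) auto
  also have "(real m)\<^sup>2 = real m powr 2" using assms by (simp add: powr_numeral)
  also have "real m powr (- 2 * p) / real m powr 2 = real m powr (- (1 + 2 * p) - 1)"
  proof -
    have "- 2 * p - 2 = - (1 + 2 * p) - 1" by simp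
    then show ?thesis unfolding powr_diff[symmetric] by (simp only:)
  qed
  finally show ?thesis .
qed

lemma summable_lam_powr_div:
  assumes "p \<ge> 0"
  shows "summable (\<lambda>m. lam (Suc m) powr (- p) / lam (Suc m))"
proof (rule summable_comparison_test')
  show "summable (\<lambda>m. real (Suc m) powr (- (1 + 2 * p) - 1))"
    using assms by (subst summable_Suc_iff) (simp add: summable_real_powr_iff)
  show "norm (lam (Suc m) powr (- p) / lam (Suc m)) \<le> real (Suc m) powr (- (1 + 2 * p) - 1)" if "m \<ge> 0" for m
    using lam_powr_div_le[of "Suc m" p] lam_pos[of "Suc m"] assms by simp
qed

text \<open>The sum is split at the frequency \<open>h powr (- 1/2)\<close>, where \<open>lam m * h\<close> is of order one. Below it the error of a mode
is estimated by \<open>h\<close> and above it by \<open>1 / lam m\<close>.\<close>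

lemma suminf_mode_error_le:
  assumes p: "0 \<le> p" "p < 1/2" and h: "0 < h" "h < 1"
  defines "g \<equiv> \<lambda>m. lam (Suc m) powr (- p) * (min 1 (lam (Suc m) * h) / lam (Suc m))"
  shows "summable g" "suminf g \<le> (2 / (1 - 2 * p) + 1) * h powr (p + 1/2)"
proof -
  define s r where "s = 1 - 2 * p" and "r = 1 + 2 * p"
  have sr: "0 < s" "s \<le> 1" "1 \<le> r" using p by (auto simp: s_def r_def)
  define a where "a = h powr (- 1/2)"
  define K where "K = nat \<lceil>a\<rceil>"
  have a1: "a \<ge> 1"
    using powr_mono2'[of "- 1/2" h 1] h by (simp add: a_def)
  \<comment> \<open>Rounding the splitting point up costs at most a factor \<open>2\<close>, because \<open>h < 1\<close>.\<close>
  have K: "a \<le> real K" "real K \<le> 2 * a"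
    using a1 unfolding K_def by linarith+
  have K1: "K \<ge> 1" using K a1 by linarith
  have lp: "lam (Suc m) > 0" for m by (rule lam_pos) simp
  have g0: "g m \<ge> 0" for m
    unfolding g_def using lp[of m] h by simp
  have g1: "g m \<le> h * real (Suc m) powr (s - 1)" for m
  proof -
    have "g m \<le> lam (Suc m) powr (- p) * ((lam (Suc m) * h) / lam (Suc m))"
      unfolding g_def using lp[of m] by (intro mult_left_mono divide_right_mono) auto
    also have "\<dots> = h * lam (Suc m) powr (- p)" using lp[of m] by simp
    also have "\<dots> \<le> h * real (Suc m) powr (- 2 * p)"
      using h p by (intro mult_left_mono lam_powr_le) auto
    finally show ?thesis by (simp add: s_def)
  qed
  have g2: "g m \<le> real (Suc m) powr (- r - 1)" for m
  proof -
    have "g m \<le> lam (Suc m) powr (- p) * (1 / lam (Suc m))"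
      unfolding g_def using lp[of m] by (intro mult_left_mono divide_right_mono) auto
    also have "\<dots> \<le> real (Suc m) powr (- r - 1)"
      using lam_powr_div_le[of "Suc m" p] p by (simp add: r_def)
    finally show ?thesis .
  qed
  have bound: "(\<Sum>m<M. g m) \<le> (2 / s + 1) * h powr (p + 1/2)" for M
  proof -
    have "(\<Sum>m<M. g m) \<le> (\<Sum>m<max K M. g m)"
      using g0 by (intro sum_mono2) auto
    also have "\<dots> = (\<Sum>m<K. g m) + (\<Sum>m\<in>{K..<max K M}. g m)"
      by (simp add: sum.atLeastLessThan_concat lessThan_atLeast0)
    also have "\<dots> \<le> (\<Sum>m<K. h * real (Suc m) powr (s - 1)) + (\<Sum>m\<in>{K..<max K M}. real (Suc m) powr (- r - 1))"
      by (intro add_mono sum_mono g1 g2)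
    also have "\<dots> \<le> h * (real K powr s / s) + (real K powr (- r) - real (max K M) powr (- r))"
      unfolding sum_distrib_left[symmetric]
      using h sr K1 by (intro add_mono mult_left_mono sum_powr_le sum_powr_tail_le) auto
    also have "\<dots> \<le> h * ((2 * a) powr s / s) + a powr (- r)"
    proof (intro add_mono mult_left_mono divide_right_mono)
      show "real K powr s \<le> (2 * a) powr s" using K sr by (intro powr_mono2) auto
      have "real K powr (- r) \<le> a powr (- r)" using K a1 sr by (intro powr_mono2') auto
      then show "real K powr (- r) - real (max K M) powr (- r) \<le> a powr (- r)"
        using powr_ge_zero[of "real (max K M)" "- r"] by linarith
    qed (use h sr in auto)
    also have "\<dots> \<le> 2 * (h * a powr s) / s + a powr (- r)"
    proof -
      have "(2 * a) powr s \<le> 2 * a powr s"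
        using powr_mono[of s 1 2] sr a1 by (simp add: powr_mult mult_right_mono)
      then have "h * ((2 * a) powr s / s) \<le> h * (2 * a powr s / s)"
        using h sr by (intro mult_left_mono divide_right_mono) auto
      then show ?thesis by (simp add: mult_ac)
    qed
    also have "h * a powr s = h powr (p + 1/2)"
    proof -
      have "h * a powr s = h powr 1 * h powr (- 1/2 * s)" using h by (simp add: a_def powr_powr)
      also have "\<dots> = h powr (1 + - 1/2 * s)" by (rule powr_add[symmetric])
      also have "1 + - 1/2 * s = p + 1/2" by (simp add: s_def field_simps)
      finally show ?thesis .
    qed
    also have "a powr (- r) = h powr (p + 1/2)"
    proof -
      have "- 1/2 * - r = p + 1/2" by (simp add: r_def field_simps)
      then show ?thesis unfolding a_def powr_powr by (simp only:)
    qed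
    finally show ?thesis by (simp add: algebra_simps)
  qed
  show "summable g" by (rule summableI_nonneg_bounded[OF g0 bound])
  then show "suminf g \<le> (2 / (1 - 2 * p) + 1) * h powr (p + 1/2)"
    using suminf_le_const[OF _ bound] by (simp add: s_def)
qed

text \<open>Passing from \<open>sqrt\<close> to its square and from \<^const>\<open>suminf\<close> to a sum of expectations requires the series to
converge for almost every \<open>\<omega>\<close>. This follows from the convergence of the expectations.\<close>

lemma integral_weighted_square_sum:
  fixes Z :: "nat \<Rightarrow> 'w \<Rightarrow> real"
  assumes Z [measurable]: "\<And>m. Z m \<in> borel_measurable M"
    and v: "\<And>m. (\<integral>\<^sup>+\<omega>. ennreal ((Z m \<omega>)\<^sup>2) \<partial>M) = ennreal (v m)" "\<And>m. 0 \<le> v m"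
    and w: "\<And>m. 0 \<le> w m" and sm: "summable (\<lambda>m. w m * v m)"
  shows "(LINT \<omega>|M. (sqrt (\<Sum>m. w m * (Z m \<omega>)\<^sup>2))\<^sup>2) = (\<Sum>m. w m * v m)"
proof -
  have n: "(\<integral>\<^sup>+\<omega>. ennreal (w m * (Z m \<omega>)\<^sup>2) \<partial>M) = ennreal (w m * v m)" for m
    using w v by (simp add: ennreal_mult' nn_integral_cmult)
  have int: "integrable M (\<lambda>\<omega>. w m * (Z m \<omega>)\<^sup>2)" for m
    using w n[of m] by (intro integrableI_nonneg) auto
  have ival: "(LINT \<omega>|M. w m * (Z m \<omega>)\<^sup>2) = w m * v m" for m
    using w v n[of m] by (subst integral_eq_nn_integral) auto
  have "(\<integral>\<^sup>+\<omega>. (\<Sum>m. ennreal (w m * (Z m \<omega>)\<^sup>2)) \<partial>M) = (\<Sum>m. ennreal (w m * v m))"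
    by (subst nn_integral_suminf) (auto simp: n)
  also have "\<dots> \<noteq> \<infinity>"
    using sm w v by (simp add: suminf_ennreal2)
  finally have "AE \<omega> in M. (\<Sum>m. ennreal (w m * (Z m \<omega>)\<^sup>2)) \<noteq> \<infinity>"
    by (intro nn_integral_PInf_AE) auto
  then have ae: "AE \<omega> in M. summable (\<lambda>m. w m * (Z m \<omega>)\<^sup>2)"
    by eventually_elim (use w in \<open>auto intro!: summable_suminf_not_top\<close>)
  have "(LINT \<omega>|M. (sqrt (\<Sum>m. w m * (Z m \<omega>)\<^sup>2))\<^sup>2) = (LINT \<omega>|M. (\<Sum>m. w m * (Z m \<omega>)\<^sup>2))"
  proof (rule integral_cong_AE)
    show "AE \<omega> in M. (sqrt (\<Sum>m. w m * (Z m \<omega>)\<^sup>2))\<^sup>2 = (\<Sum>m. w m * (Z m \<omega>)\<^sup>2)"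
      using ae by eventually_elim (use w in \<open>auto intro!: real_sqrt_pow2 suminf_nonneg\<close>)
  qed auto
  also have "\<dots> = (\<Sum>m. LINT \<omega>|M. w m * (Z m \<omega>)\<^sup>2)"
  proof (intro integral_suminf int)
    have "norm (w m * (Z m \<omega>)\<^sup>2) = w m * (Z m \<omega>)\<^sup>2" for m \<omega>
      using w by simp
    then show "AE \<omega> in M. summable (\<lambda>m. norm (w m * (Z m \<omega>)\<^sup>2))"
      "summable (\<lambda>m. LINT \<omega>|M. norm (w m * (Z m \<omega>)\<^sup>2))"
      using ae sm unfolding ival[symmetric] by (simp_all only:)
  qed
  finally show ?thesis unfolding ival .
qed

section \<open>The weak error of the implicit Euler scheme\<close>

theorem theorem2p1:
  fixes M :: "'w measure"
    and W :: "real \<Rightarrow> (real \<Rightarrow> real) \<Rightarrow> 'w \<Rightarrow> real"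
    and X :: "real \<Rightarrow> 'w \<Rightarrow> real \<Rightarrow> real"
    and T p :: real
  assumes "prob_space M"
    and "0 < T"
    and "cylindrical_BM M W"
    and "heat_solution M W T X"
    and "0 \<le> p" and "p < 1/2"
  shows "\<exists>C>0. \<forall>N\<ge>1. \<forall>XN :: nat \<Rightarrow> 'w \<Rightarrow> real \<Rightarrow> real.
           T / real N < 1 \<longrightarrow> implicit_euler M W T N XN \<longrightarrow>
           \<bar>(LINT \<omega>|M. (Hneg_norm p (XN N \<omega>))\<^sup>2) - (LINT \<omega>|M. (Hneg_norm p (X T \<omega>))\<^sup>2)\<bar>
             \<le> C * (T / real N) powr (p + 1/2)"
proof (intro exI conjI allI impI)
  show "2 / (1 - 2 * p) + 1 > 0" using assms(6) by (simp add: add_pos_pos)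
  fix N and XN :: "nat \<Rightarrow> 'w \<Rightarrow> real \<Rightarrow> real"
  assume N: "N \<ge> 1" and h1: "T / real N < 1" and XN: "implicit_euler M W T N XN"
  define h where "h = T / real N"
  have h: "0 < h" "h < 1" "T = real N * h" using N h1 assms(2) by (auto simp: h_def)
  define w where "w m = lam (Suc m) powr (- p)" for m
  define a where "a m = (1 - (1 / (1 + lam (Suc m) * h)) ^ (2 * N)) / (2 * lam (Suc m) + (lam (Suc m))\<^sup>2 * h)" for m
  define b where "b m = (1 - exp (- 2 * lam (Suc m) * T)) / (2 * lam (Suc m))" for m
  have l: "lam (Suc m) > 0" for m by (rule lam_pos) simp
  have sw: "summable (\<lambda>m. w m / lam (Suc m))"
    unfolding w_def by (rule summable_lam_powr_div) fact
  have a: "0 \<le> a m" "a m \<le> 1 / lam (Suc m)" for m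
  proof -
    have q: "0 \<le> 1 / (1 + lam (Suc m) * h)" "1 / (1 + lam (Suc m) * h) \<le> 1"
      using mult_pos_pos[OF l[of m] h(1)] by simp_all
    have d: "lam (Suc m) \<le> 2 * lam (Suc m) + (lam (Suc m))\<^sup>2 * h"
      using l[of m] h by simp
    have "(1 / (1 + lam (Suc m) * h)) ^ (2 * N) \<le> 1" by (rule power_le_one[OF q])
    then show "0 \<le> a m"
      unfolding a_def using l[of m] d by (intro divide_nonneg_nonneg) auto
    have "1 - (1 / (1 + lam (Suc m) * h)) ^ (2 * N) \<le> 1" using q(1) by simp
    then show "a m \<le> 1 / lam (Suc m)"
      unfolding a_def using l[of m] d by (intro frac_le) auto
  qed
  have b: "0 \<le> b m" "b m \<le> 1 / lam (Suc m)" for m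
  proof -
    show "0 \<le> b m" unfolding b_def using l[of m] assms(2) by simp
    show "b m \<le> 1 / lam (Suc m)" unfolding b_def using l[of m] by (intro frac_le) auto
  qed
  have w0: "0 \<le> w m" for m by (simp add: w_def)
  have summable_w: "summable (\<lambda>m. w m * c m)" if "\<And>m. 0 \<le> c m" "\<And>m. c m \<le> 1 / lam (Suc m)" for c
  proof (rule summable_comparison_test'[OF sw])
    show "norm (w m * c m) \<le> w m / lam (Suc m)" if "m \<ge> 0" for m
      using mult_left_mono[OF \<open>c m \<le> 1 / lam (Suc m)\<close> w0[of m]] \<open>0 \<le> c m\<close> w0[of m] by simp
  qed
  have L2: "sin_basis (Suc m) \<in> L2" for m by (rule sin_basis_in_L2)
  have "(LINT \<omega>|M. (Hneg_norm p (XN N \<omega>))\<^sup>2) = (\<Sum>m. w m * a m)"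
    unfolding Hneg_norm_def w_def[symmetric]
  proof (rule integral_weighted_square_sum)
    show "(\<integral>\<^sup>+\<omega>. ennreal ((L2_inner (XN N \<omega>) (sin_basis (Suc m)))\<^sup>2) \<partial>M) = ennreal (a m)" for m
      unfolding a_def h_def using N by (intro implicit_euler_mode_second_moment[OF assms(2,3) XN]) auto
    show "(\<lambda>\<omega>. L2_inner (XN N \<omega>) (sin_basis (Suc m))) \<in> borel_measurable M" for m
      by (intro implicit_euler_mode_measurable[OF XN] L2) simp
  qed (auto intro: a w0 summable_w)
  moreover have "(LINT \<omega>|M. (Hneg_norm p (X T \<omega>))\<^sup>2) = (\<Sum>m. w m * b m)"
    unfolding Hneg_norm_def w_def[symmetric]
  proof (rule integral_weighted_square_sum)
    show meas: "(\<lambda>\<omega>. L2_inner (X T \<omega>) (sin_basis (Suc m))) \<in> borel_measurable M" for m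
      by (intro heat_solution_mode_measurable(2)[OF assms(4,2)] L2)
    show "(\<integral>\<^sup>+\<omega>. ennreal ((L2_inner (X T \<omega>) (sin_basis (Suc m)))\<^sup>2) \<partial>M) = ennreal (b m)" for m
      using heat_solution_mode_distribution[OF assms(1-4), of "Suc m"] b(1)[of m]
      by (intro second_moment_of_centered_normal meas) (auto simp: b_def)
  qed (auto intro: b w0 summable_w)
  ultimately have "(LINT \<omega>|M. (Hneg_norm p (XN N \<omega>))\<^sup>2) - (LINT \<omega>|M. (Hneg_norm p (X T \<omega>))\<^sup>2)
     = (\<Sum>m. w m * (a m - b m))"
    using suminf_diff[OF summable_w[OF a] summable_w[OF b]] by (simp add: right_diff_distrib)
  also have "\<bar>\<dots>\<bar> \<le> (\<Sum>m. w m * (min 1 (lam (Suc m) * h) / lam (Suc m)))"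
  proof -
    note S = suminf_mode_error_le(1)[OF assms(5,6) h(1,2), folded w_def]
    have "norm (w m * (a m - b m)) \<le> w m * (min 1 (lam (Suc m) * h) / lam (Suc m))" for m
      using mult_left_mono[OF mode_variance_error[OF l[of m] h(1,3)] w0[of m]] w0[of m]
      by (simp add: a_def b_def abs_mult)
    from norm_suminf_le[OF this S] show ?thesis by (simp only: real_norm_def)
  qed
  also have "\<dots> \<le> (2 / (1 - 2 * p) + 1) * h powr (p + 1/2)"
    unfolding w_def by (rule suminf_mode_error_le(2)[OF assms(5,6) h(1,2)])
  finally show "\<bar>(LINT \<omega>|M. (Hneg_norm p (XN N \<omega>))\<^sup>2) - (LINT \<omega>|M. (Hneg_norm p (X T \<omega>))\<^sup>2)\<bar>
             \<le> (2 / (1 - 2 * p) + 1) * (T / real N) powr (p + 1/2)"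
    by (simp add: h_def)
qed

end
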